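(* Let $\tilde P_c\in\partial\mathcal F$. Then there exist unique vectors $\tilde V_L\in\partial\mathcal D$ and $\mu\in\mathcal M_1$ such that $\tilde P_c=P_c(\tilde V_L)$ and $\tilde V_L=\psi(\mu)$. These vectors satisfy $$\tilde P_c=[\tilde V_L]^2[\mu]^{-1}Y_{LL}\,\mu .$$ This implies that the boundary of $\mathcal F$ is parametrized by $$\partial\mathcal F=\{\,[\psi(\mu)]^2[\mu]^{-1}Y_{LL}\,\mu \;:\; \mu\in\mathcal M_1\,\}.$$
   Context: Notation: $[x]=\operatorname{diag}(x_1,\dots,x_k)$ for a vector $x$; $\mathbf 1,\mathbf 0$ are the all-ones and all-zeros vectors; vector and matrix inequalities are element-wise; $\|\cdot\|_1$ is the 1-norm. A Z-matrix is a real square matrix with nonpositive off-diagonal entries; an M-matrix is a Z-matrix all of whose eigenvalues have nonnegative real part. Setting: a DC power grid with $n\ge1$ loads and $m\ge1$ sources. Its Kirchhoff matrix $Y=\begin{pmatrix} Y_{LL} & Y_{LS} \\ Y_{SL} & Y_{SS} \end{pmatrix}\in\mathbb R^{(n+m)\times(n+m)}$ is the weighted Laplacian of a connected undirected graph with positive edge weights (symmetric, nonpositive off-diagonal entries, zero row sums), partitioned according to loads and sources, and the $n\times n$ matrix $Y_{LL}$ is irreducible; hence $Y_{LL}$ is a symmetric positive definite irreducible nonsingular M-matrix. The source voltages $V_S\in\mathbb R^m$, $V_S>\mathbf 0$, are fixed. Put $\mathcal I_L^*=-Y_{LS}V_S$ (which satisfies $\mathcal I_L^*\ge\mathbf 0$,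 $\mathcal I_L^*\ne\mathbf 0$) and $V_L^*=Y_{LL}^{-1}\mathcal I_L^*$ (which satisfies $V_L^*>\mathbf 0$). For $V_L\in\mathbb R^n$ put $P_c(V_L)=[V_L]Y_{LL}(V_L^*-V_L)$, with Jacobian $\frac{\partial P_c}{\partial V_L}(V_L)=[Y_{LL}(V_L^*-V_L)]-[V_L]Y_{LL}$. The set of feasible power demands is $\mathcal F=\{P_c(V_L): V_L\in\mathbb R^n,\ V_L>\mathbf 0\}$, with boundary $\partial\mathcal F$ in $\mathbb R^n$. $\mathcal D$ is the set of all $V_L>\mathbf 0$ such that $\frac{\partial P_c}{\partial V_L}(V_L)$ is nonsingular and its inverse has only negative entries; $\partial\mathcal D$ is its boundary in $\mathbb R^n$. For $\mu\in\mathbb R^n$ put $g(\mu)=[\mu]Y_{LL}+[Y_{LL}\mu]$. $\mathcal M=\{\mu\in\mathbb R^n: g(\mu)\text{ is a nonsingular M-matrix}\}$ and $\mathcal M_1=\{\mu\in\mathcal M:\|\mu\|_1=1\}$ (elements of $\mathcal M$ are positive vectors). For $\mu\in\mathcal M$ put $\psi(\mu)=g(\mu)^{-1}[\mu]\mathcal I_L^*$. *)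

theory Defs
  imports "HOL-Analysis.Analysis"
begin

text \<open>The library order on \<open>real^'n\<close> makes \<open>0 < x\<close> mean \<open>0 \<le> x \<and> x \<noteq> 0\<close>, so the element-wise
  strict inequality is written out.\<close>

definition pos_vec :: "real^'n \<Rightarrow> bool" where
  "pos_vec x \<longleftrightarrow> (\<forall>i. 0 < x $ i)"

definition diag_mat :: "real^'n \<Rightarrow> real^'n^'n" where
  "diag_mat x = (\<chi> i j. if i = j then x $ i else 0)"

definition one_norm :: "real^'n \<Rightarrow> real" where
  "one_norm x = (\<Sum>i\<in>UNIV. \<bar>x $ i\<bar>)"

definition Z_matrix :: "real^'n^'n \<Rightarrow> bool" where
  "Z_matrix A \<longleftrightarrow> (\<forall>i j. i \<noteq> j \<longrightarrow> A $ i $ j \<le> 0)"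

definition complex_eigenvalue :: "real^'n^'n \<Rightarrow> complex \<Rightarrow> bool" where
  "complex_eigenvalue A z \<longleftrightarrow>
    (\<exists>v :: complex^'n. v \<noteq> 0 \<and> map_matrix complex_of_real A *v v = z *s v)"

definition M_matrix :: "real^'n^'n \<Rightarrow> bool" where
  "M_matrix A \<longleftrightarrow> Z_matrix A \<and> (\<forall>z. complex_eigenvalue A z \<longrightarrow> 0 \<le> Re z)"

text \<open>A matrix is reducible if a simultaneous permutation of rows and columns brings it to block
  triangular form with two nonempty diagonal blocks; \<open>S\<close> and \<open>- S\<close> are the index sets of the blocks.
  In particular every \<open>1 \<times> 1\<close> matrix is irreducible.\<close>

definition irreducible_matrix :: "real^'n^'n \<Rightarrow> bool" where
  "irreducible_matrix A \<longleftrightarrow>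
    \<not> (\<exists>S. S \<noteq> {} \<and> S \<noteq> UNIV \<and> (\<forall>i\<in>S. \<forall>j\<in>- S. A $ i $ j = 0))"

text \<open>The vertices \<open>i \<noteq> j\<close> are joined by an edge of weight \<open>- Y $ i $ j\<close> when this entry is nonzero.\<close>

definition kirchhoff_matrix :: "real^'v^'v \<Rightarrow> bool" where
  "kirchhoff_matrix Y \<longleftrightarrow>
    transpose Y = Y \<and>
    (\<forall>i j. i \<noteq> j \<longrightarrow> Y $ i $ j \<le> 0) \<and>
    (\<forall>i. (\<Sum>j\<in>UNIV. Y $ i $ j) = 0) \<and>
    (\<forall>i j. (i, j) \<in> {(k, l). k \<noteq> l \<and> Y $ k $ l \<noteq> 0}\<^sup>*)"

text \<open>Vertices \<open>Inl i\<close> are loads, vertices \<open>Inr j\<close> are sources.\<close>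

definition Y_LL :: "real^('n::finite + 'm::finite)^('n + 'm) \<Rightarrow> real^'n^'n" where
  "Y_LL Y = (\<chi> i j. Y $ Inl i $ Inl j)"

definition Y_LS :: "real^('n::finite + 'm::finite)^('n + 'm) \<Rightarrow> real^'m^'n" where
  "Y_LS Y = (\<chi> i j. Y $ Inl i $ Inr j)"

definition I_star :: "real^('n::finite + 'm::finite)^('n + 'm) \<Rightarrow> real^'m \<Rightarrow> real^'n" where
  "I_star Y V\<^sub>S = - (Y_LS Y *v V\<^sub>S)"

definition V_star :: "real^('n::finite + 'm::finite)^('n + 'm) \<Rightarrow> real^'m \<Rightarrow> real^'n" where
  "V_star Y V\<^sub>S = matrix_inv (Y_LL Y) *v I_star Y V\<^sub>S"

definition P_c :: "real^('n::finite + 'm::finite)^('n + 'm) \<Rightarrow> real^'m \<Rightarrow> real^'n \<Rightarrow> real^'n" where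
  "P_c Y V\<^sub>S V = diag_mat V *v (Y_LL Y *v (V_star Y V\<^sub>S - V))"

definition feasible :: "real^('n::finite + 'm::finite)^('n + 'm) \<Rightarrow> real^'m \<Rightarrow> (real^'n) set" where
  "feasible Y V\<^sub>S = {P_c Y V\<^sub>S V | V. pos_vec V}"

definition D_set :: "real^('n::finite + 'm::finite)^('n + 'm) \<Rightarrow> real^'m \<Rightarrow> (real^'n) set" where
  "D_set Y V\<^sub>S = {V. pos_vec V \<and> invertible (jacobian (P_c Y V\<^sub>S) (at V)) \<and>
     (\<forall>i j. matrix_inv (jacobian (P_c Y V\<^sub>S) (at V)) $ i $ j < 0)}"

definition g_mat :: "real^('n::finite + 'm::finite)^('n + 'm) \<Rightarrow> real^'n \<Rightarrow> real^'n^'n" where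
  "g_mat Y \<mu> = diag_mat \<mu> ** Y_LL Y + diag_mat (Y_LL Y *v \<mu>)"

definition M_set :: "real^('n::finite + 'm::finite)^('n + 'm) \<Rightarrow> (real^'n) set" where
  "M_set Y = {\<mu>. M_matrix (g_mat Y \<mu>) \<and> invertible (g_mat Y \<mu>)}"

definition M1_set :: "real^('n::finite + 'm::finite)^('n + 'm) \<Rightarrow> (real^'n) set" where
  "M1_set Y = {\<mu> \<in> M_set Y. one_norm \<mu> = 1}"

definition psi :: "real^('n::finite + 'm::finite)^('n + 'm) \<Rightarrow> real^'m \<Rightarrow> real^'n \<Rightarrow> real^'n" where
  "psi Y V\<^sub>S \<mu> = matrix_inv (g_mat Y \<mu>) *v (diag_mat \<mu> *v I_star Y V\<^sub>S)"

lemma diag_mat_mult_vec: "diag_mat x *v y = (\<chi> i. x $ i * y $ i)"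
proof -
  have "(\<Sum>j\<in>UNIV. (if i = j then x $ i else 0) * y $ j) = x $ i * y $ i" for i
    by (subst sum.cong[OF refl, of _ _ "\<lambda>j. if j = i then x $ i * y $ i else 0"]) auto
  then show ?thesis
    by (simp add: vec_eq_iff diag_mat_def matrix_vector_mult_def)
qed

lemma P_c_has_derivative:
  "(P_c Y V\<^sub>S has_derivative
     (\<lambda>h. (diag_mat (Y_LL Y *v (V_star Y V\<^sub>S - V)) - diag_mat V ** Y_LL Y) *v h)) (at V)"
proof -
  let ?A = "Y_LL Y" and ?W = "V_star Y V\<^sub>S"
  have lin: "((\<lambda>V. ?A *v (?W - V)) has_derivative (\<lambda>h. ?A *v (0 - h))) (at V)"
    by (rule bounded_linear.has_derivative[OF matrix_vector_mul_bounded_linear])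
       (intro derivative_intros)
  have comp: "((\<lambda>V. (?A *v (?W - V)) $ i) has_derivative (\<lambda>h. (?A *v (0 - h)) $ i)) (at V)" for i
    by (rule bounded_linear.has_derivative[OF bounded_linear_vec_nth lin])
  have id: "((\<lambda>V. V $ i) has_derivative (\<lambda>h. h $ i)) (at V)" for i :: 'a
    by (rule bounded_linear_imp_has_derivative[OF bounded_linear_vec_nth])
  have "((\<lambda>V. V $ i * (?A *v (?W - V)) $ i) has_derivative
      (\<lambda>h. V $ i * (?A *v (0 - h)) $ i + h $ i * (?A *v (?W - V)) $ i)) (at V)" for i
    by (rule has_derivative_mult[OF id comp])
  moreover have "((diag_mat (?A *v (?W - V)) - diag_mat V ** ?A) *v h) $ i
      = V $ i * (?A *v (0 - h)) $ i + h $ i * (?A *v (?W - V)) $ i" for h i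
  proof -
    have "?A *v (0 - h) = - (?A *v h)"
      by (metis matrix_vector_mult_diff_distrib matrix_vector_mult_0_right diff_0)
    then show ?thesis
      by (simp add: matrix_vector_mult_diff_rdistrib diag_mat_mult_vec
          flip: matrix_vector_mul_assoc)
  qed
  ultimately have "((\<lambda>V. P_c Y V\<^sub>S V $ i) has_derivative
      (\<lambda>h. ((diag_mat (?A *v (?W - V)) - diag_mat V ** ?A) *v h) $ i)) (at V)" for i
    by (simp add: P_c_def diag_mat_mult_vec)
  then show ?thesis
    by (subst has_derivative_componentwise_within) (auto simp: Basis_vec_def inner_axis)
qed

lemma jacobian_P_c:
  "jacobian (P_c Y V\<^sub>S) (at V)
     = diag_mat (Y_LL Y *v (V_star Y V\<^sub>S - V)) - diag_mat V ** Y_LL Y"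
  unfolding jacobian_def frechet_derivative_at[OF P_c_has_derivative, symmetric]
  by (rule matrix_of_matrix_vector_mul)

end

theory Submission
  imports Defs
begin

text \<open>Write \<open>A = Y\<^sub>L\<^sub>L\<close> and \<open>b = I\<^sub>L\<^sup>*\<close>. All boundary objects are controlled by the pairs \<open>V, m > 0\<close> for which
  \<open>m\<close> spans the kernel of the Jacobian at \<open>V\<close>; by symmetry of the roles of \<open>V\<close> and \<open>m\<close> this reads
  \<open>g(m) V = [m]b\<close>. Perron vectors of irreducible Z-matrices, obtained from Brouwer's theorem, identify
  the points \<open>V\<close> of such pairs with \<open>\<partial>D\<close> and the vectors \<open>m\<close> with \<open>M\<close>. If \<open>p = P\<^sub>c(V)\<close> is a boundary
  point of \<open>F\<close>, a Perron vector of the Jacobian at \<open>V\<close> whose eigenvalue is nonzero would be a direction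
  in which all powers increase, so the Jacobian has a positive null vector. Conversely, pairing \<open>P\<^sub>c\<close> with a
  positive left null vector of the Jacobian at \<open>V\<close> gives a strictly concave quadratic function with
  critical point \<open>V\<close>. Hence \<open>P\<^sub>c(U) \<ge> P\<^sub>c(V)\<close> forces \<open>U = V\<close>, which yields both uniqueness and
  \<open>P\<^sub>c(V) \<in> \<partial>F\<close>.\<close>

section \<open>Irreducible Z-matrices\<close>

lemma irreducible_matrix_transpose:
  fixes B :: "real^'n^'n"
  assumes "irreducible_matrix B"
  shows "irreducible_matrix (transpose B)"
  unfolding irreducible_matrix_def
proof clarify
  fix S :: "'n set"
  assume "S \<noteq> {}" "S \<noteq> UNIV" "\<forall>i\<in>S. \<forall>j\<in>- S. transpose B $ i $ j = 0"
  then have "- S \<noteq> {} \<and> - S \<noteq> UNIV \<and> (\<forall>i\<in>- S. \<forall>j\<in>- (- S). B $ i $ j = 0)"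
    by (simp add: transpose_def Compl_eq_Diff_UNIV Diff_eq_empty_iff) blast
  with assms show False
    unfolding irreducible_matrix_def by (metis (no_types))
qed

lemma irreducible_matrix_cong:
  assumes "irreducible_matrix A" "\<And>i j. i \<noteq> j \<Longrightarrow> A $ i $ j \<noteq> 0 \<Longrightarrow> B $ i $ j \<noteq> 0"
  shows "irreducible_matrix B"
  using assms unfolding irreducible_matrix_def
  by (metis Compl_iff)

lemma Z_matrix_transpose: "Z_matrix B \<Longrightarrow> Z_matrix (transpose B)"
  by (auto simp: Z_matrix_def transpose_def)

lemma pos_vec_neq_0: "pos_vec (x::real^'n) \<Longrightarrow> x \<noteq> 0"
  by (auto simp: pos_vec_def)

text \<open>In a row where \<open>x\<close> vanishes, every term \<open>B $ i $ k * x $ k\<close> is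
  nonpositive, so a nonnegative sum makes all of them zero. Hence \<open>B\<close> has no entries
  from the zero set of \<open>x\<close> to its complement, and irreducibility leaves only the two
  trivial zero sets.\<close>

lemma irreducible_Z_matrix_zero_or_pos:
  fixes B :: "real^'n^'n"
  assumes Z: "Z_matrix B" and irr: "irreducible_matrix B"
    and x: "\<And>i. 0 \<le> x $ i" and Bx: "\<And>i. x $ i = 0 \<Longrightarrow> 0 \<le> (B *v x) $ i"
  shows "x = 0 \<or> pos_vec x"
proof (rule ccontr)
  define S where "S = {i. x $ i = 0}"
  assume "\<not> (x = 0 \<or> pos_vec x)"
  then have S: "S \<noteq> UNIV" "S \<noteq> {}"
    using x by (auto simp: S_def pos_vec_def vec_eq_iff less_le)
  have "B $ i $ j = 0" if i: "i \<in> S" and j: "j \<in> - S" for i j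
  proof -
    have nonpos: "B $ i $ k * x $ k \<le> 0" for k
      using Z i x[of k] by (cases "k = i") (auto simp: Z_matrix_def S_def mult_nonpos_nonneg)
    have "0 \<le> (\<Sum>k\<in>UNIV. B $ i $ k * x $ k)"
      using Bx[of i] i by (simp add: S_def matrix_vector_mult_def)
    then have "(\<Sum>k\<in>UNIV. - (B $ i $ k * x $ k)) = 0"
      using sum_nonpos[of UNIV "\<lambda>k. B $ i $ k * x $ k"] nonpos by (auto simp: sum_negf)
    then have "B $ i $ j * x $ j = 0"
      using nonpos by (subst (asm) sum_nonneg_eq_0_iff) auto
    then show ?thesis
      using j by (simp add: S_def)
  qed
  with S irr show False
    unfolding irreducible_matrix_def by blast
qed

lemma inner_pos_vec_pos:
  fixes x y :: "real^'n"
  assumes "pos_vec x" "\<And>i. 0 \<le> y $ i" "y \<noteq> 0"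
  shows "0 < x \<bullet> y"
proof -
  obtain i where "y $ i \<noteq> 0"
    using assms(3) by (auto simp: vec_eq_iff)
  then have "0 < y $ i"
    using assms(2)[of i] by simp
  then show ?thesis
    using assms(1,2) unfolding inner_vec_def pos_vec_def
    by (intro sum_pos2[of _ i]) (auto simp: less_imp_le)
qed

text \<open>For large \<open>c\<close> the map \<open>c *\<^sub>R x - B *v x\<close>, divided by its
  coordinate sum, sends the standard simplex into itself. A Brouwer fixed point is a nonnegative
  eigenvector of \<open>B\<close>, and the zero-or-positive dichotomy makes it positive.\<close>

lemma irreducible_Z_matrix_eigenvector:
  fixes B :: "real^'n^'n"
  assumes Z: "Z_matrix B" and irr: "irreducible_matrix B"
  obtains r w where "pos_vec w" "B *v w = r *\<^sub>R w"
proof -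
  \<comment> \<open>The summand 1 ensures \<open>c - B $ i $ i \<ge> 1\<close>, hence
    \<open>T x \<ge> x\<close> on the simplex, so that the divisor \<open>s x\<close> is at least
    1.\<close>
  define c where "c = 1 + (\<Sum>i\<in>UNIV. \<bar>B $ i $ i\<bar>)"
  define T where "T x = c *\<^sub>R x - B *v x" for x
  define s where "s x = (\<Sum>i\<in>UNIV. T x $ i)" for x
  define X :: "(real^'n) set" where "X = {x. (\<forall>i. 0 \<le> x $ i) \<and> (\<Sum>i\<in>UNIV. x $ i) = 1}"
  have c: "1 \<le> c - B $ i $ i" for i
    using member_le_sum[of i UNIV "\<lambda>i. \<bar>B $ i $ i\<bar>"] by (auto simp: c_def)
  have T: "x $ i \<le> T x $ i" if "\<And>j. 0 \<le> x $ j" for x i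
  proof -
    have "(\<Sum>j\<in>UNIV - {i}. B $ i $ j * x $ j) \<le> 0"
      using Z that by (intro sum_nonpos) (auto simp: Z_matrix_def mult_nonpos_nonneg)
    moreover have "(B *v x) $ i = B $ i $ i * x $ i + (\<Sum>j\<in>UNIV - {i}. B $ i $ j * x $ j)"
      unfolding matrix_vector_mult_def by (simp add: sum.remove[of _ i])
    moreover have "1 * x $ i \<le> (c - B $ i $ i) * x $ i"
      using c that by (intro mult_right_mono) auto
    ultimately show ?thesis
      by (simp add: T_def algebra_simps)
  qed
  have s: "1 \<le> s x" if "x \<in> X" for x
  proof -
    have "(\<Sum>i\<in>UNIV. x $ i) \<le> s x"
      unfolding s_def using that by (intro sum_mono T) (auto simp: X_def)
    then show ?thesis
      using that by (simp add: X_def)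
  qed
  have contT: "continuous_on X T"
    unfolding T_def by (intro continuous_intros linear_continuous_on matrix_vector_mul_bounded_linear)
  then have conts: "continuous_on X s"
    unfolding s_def by (intro continuous_intros)
  have "compact X"
  proof (rule compact_eq_bounded_closed[THEN iffD2], intro conjI)
    have "X \<subseteq> cbox 0 1"
    proof
      fix x assume "x \<in> X"
      then show "x \<in> cbox 0 1"
        using member_le_sum[of _ UNIV "\<lambda>i. x $ i"] by (auto simp: X_def mem_box_cart)
    qed
    then show "bounded X"
      using bounded_cbox bounded_subset by blast
    have "X = (\<Inter>i. {x. 0 \<le> x $ i}) \<inter> {x. (\<Sum>i\<in>UNIV. x $ i) = 1}"
      by (auto simp: X_def)
    also have "closed \<dots>"
      by (intro closed_Int closed_INT ballI closed_Collect_le closed_Collect_eq continuous_intros)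
    finally show "closed X" .
  qed
  moreover have "convex X"
    by (auto simp: X_def convex_def sum.distrib simp flip: sum_distrib_left)
  moreover have "X \<noteq> {}"
  proof -
    fix k :: 'n
    have "axis k 1 \<in> X"
      by (auto simp: X_def axis_def)
    then show ?thesis
      by blast
  qed
  moreover have "continuous_on X (\<lambda>x. inverse (s x) *\<^sub>R T x)"
    using s by (intro continuous_intros contT conts) force
  moreover have "(\<lambda>x. inverse (s x) *\<^sub>R T x) \<in> X \<rightarrow> X"
  proof
    fix x assume x: "x \<in> X"
    have "(\<Sum>i\<in>UNIV. inverse (s x) * T x $ i) = inverse (s x) * s x"
      unfolding s_def by (rule sum_distrib_left[symmetric])
    moreover have "0 \<le> T x $ i" for i
      using T[of x i] x order_trans[of 0 "x $ i"] by (auto simp: X_def)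
    ultimately show "inverse (s x) *\<^sub>R T x \<in> X"
      using s[OF x] by (auto simp: X_def)
  qed
  ultimately obtain w where w: "w \<in> X" "inverse (s w) *\<^sub>R T w = w"
    using brouwer[of X "\<lambda>x. inverse (s x) *\<^sub>R T x"] by auto
  have "T w = s w *\<^sub>R w"
    using w(2) s[OF w(1)] by (metis divideR_right inverse_eq_divide not_one_le_zero)
  then have Bw: "B *v w = (c - s w) *\<^sub>R w"
    by (simp add: T_def algebra_simps)
  have "w \<noteq> 0"
    using w(1) by (auto simp: X_def)
  with irreducible_Z_matrix_zero_or_pos[OF Z irr, of w] Bw w(1) have "pos_vec w"
    by (auto simp: X_def)
  then show ?thesis
    using Bw that by blast
qed

text \<open>The vector \<open>l\<close> is the positive eigenvector of the transpose. Evaluating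
  \<open>l \<bullet> (B *v w)\<close> from both sides, with \<open>l \<bullet> w > 0\<close>,
  identifies the two eigenvalues.\<close>

lemma irreducible_Z_matrix_perron:
  fixes B :: "real^'n^'n"
  assumes Z: "Z_matrix B" and irr: "irreducible_matrix B"
  obtains r w l where "pos_vec w" "B *v w = r *\<^sub>R w" "pos_vec l" "\<And>x. l \<bullet> (B *v x) = r * (l \<bullet> x)"
proof -
  obtain r w where w: "pos_vec w" "B *v w = r *\<^sub>R w"
    using irreducible_Z_matrix_eigenvector[OF assms] .
  obtain r' l where l: "pos_vec l" "transpose B *v l = r' *\<^sub>R l"
    using irreducible_Z_matrix_eigenvector[OF Z_matrix_transpose[OF Z]
        irreducible_matrix_transpose[OF irr]] .
  have left: "l \<bullet> (B *v x) = r' * (l \<bullet> x)" for x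
    by (metis dot_lmul_matrix inner_scaleR_left l(2) transpose_matrix_vector)
  have "0 < l \<bullet> w"
    using inner_pos_vec_pos[OF l(1), of w] w(1) pos_vec_neq_0[OF w(1)]
    by (auto simp: pos_vec_def less_imp_le)
  moreover have "r * (l \<bullet> w) = r' * (l \<bullet> w)"
    using left[of w] w(2) by simp
  ultimately have "r' = r"
    by simp
  with left have "l \<bullet> (B *v x) = r * (l \<bullet> x)" for x
    by simp
  with w l(1) show ?thesis
    by (rule that)
qed

text \<open>A weighted Gershgorin argument: in the row where \<open>cmod (v $ i) / w $ i\<close> is
  largest, \<open>z\<close> lies in the disc with centre \<open>B $ i $ i\<close> and radius
  \<open>B $ i $ i - r\<close>, whose leftmost point is \<open>r\<close>.\<close>

lemma Z_matrix_eigenvalue_Re_ge: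
  fixes B :: "real^'n^'n"
  assumes Z: "Z_matrix B" and w: "pos_vec w" "B *v w = r *\<^sub>R w"
    and z: "complex_eigenvalue B z"
  shows "r \<le> Re z"
proof -
  obtain v where v: "v \<noteq> 0" "map_matrix complex_of_real B *v v = z *s v"
    using z by (auto simp: complex_eigenvalue_def)
  define q where "q i = cmod (v $ i) / w $ i" for i
  have "Max (range q) \<in> range q"
    by (intro Max_in) auto
  then obtain i where "Max (range q) = q i"
    by blast
  then have i: "q j \<le> q i" for j
    using Max_ge[of "range q" "q j"] by simp
  have wpos: "0 < w $ j" for j
    using w(1) by (simp add: pos_vec_def)
  obtain k where "v $ k \<noteq> 0"
    using v(1) by (auto simp: vec_eq_iff)
  then have "0 < q k"
    using wpos by (simp add: q_def)
  then have qi: "0 < q i"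
    using i[of k] by simp
  have qw: "cmod (v $ j) \<le> q i * w $ j" for j
    using i[of j] wpos[of j] by (simp add: q_def pos_divide_le_eq)
  have vi: "cmod (v $ i) = q i * w $ i"
    using wpos[of i] by (simp add: q_def)
  have "z * v $ i = (\<Sum>j\<in>UNIV. complex_of_real (B $ i $ j) * v $ j)"
    using v(2) by (auto simp: vec_eq_iff matrix_vector_mult_def map_matrix_def)
  also have "\<dots> = complex_of_real (B $ i $ i) * v $ i
      + (\<Sum>j\<in>UNIV - {i}. complex_of_real (B $ i $ j) * v $ j)"
    by (simp add: sum.remove[of _ i])
  finally have "(z - complex_of_real (B $ i $ i)) * v $ i
      = (\<Sum>j\<in>UNIV - {i}. complex_of_real (B $ i $ j) * v $ j)"
    by (simp add: algebra_simps)
  then have "cmod (z - complex_of_real (B $ i $ i)) * cmod (v $ i)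
      = cmod (\<Sum>j\<in>UNIV - {i}. complex_of_real (B $ i $ j) * v $ j)"
    by (metis norm_mult)
  also have "\<dots> \<le> (\<Sum>j\<in>UNIV - {i}. cmod (complex_of_real (B $ i $ j) * v $ j))"
    by (rule norm_sum)
  also have "\<dots> \<le> (\<Sum>j\<in>UNIV - {i}. q i * (- (B $ i $ j) * w $ j))"
  proof (rule sum_mono)
    fix j assume "j \<in> UNIV - {i}"
    then have "B $ i $ j \<le> 0"
      using Z by (auto simp: Z_matrix_def)
    then have "cmod (complex_of_real (B $ i $ j) * v $ j) = - (B $ i $ j) * cmod (v $ j)"
      by (simp add: norm_mult)
    also have "\<dots> \<le> - (B $ i $ j) * (q i * w $ j)"
      using \<open>B $ i $ j \<le> 0\<close> qw by (intro mult_left_mono) auto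
    finally show "cmod (complex_of_real (B $ i $ j) * v $ j) \<le> q i * (- (B $ i $ j) * w $ j)"
      by (simp add: mult_ac)
  qed
  also have "\<dots> = q i * (B $ i $ i * w $ i - r * w $ i)"
  proof -
    have "r * w $ i = (B *v w) $ i"
      using w(2) by simp
    also have "\<dots> = B $ i $ i * w $ i + (\<Sum>j\<in>UNIV - {i}. B $ i $ j * w $ j)"
      unfolding matrix_vector_mult_def by (simp add: sum.remove[of _ i])
    finally have "B $ i $ i * w $ i - r * w $ i = (\<Sum>j\<in>UNIV - {i}. - (B $ i $ j) * w $ j)"
      by (simp add: sum_negf)
    then show ?thesis
      by (simp only: sum_distrib_left)
  qed
  also have "\<dots> = (B $ i $ i - r) * cmod (v $ i)"
    by (simp add: vi algebra_simps)
  finally have "cmod (z - complex_of_real (B $ i $ i)) \<le> B $ i $ i - r"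
    using qi wpos[of i] by (simp add: vi)
  then show ?thesis
    using abs_Re_le_cmod[of "z - complex_of_real (B $ i $ i)"] by simp
qed

lemma complex_eigenvalue_of_real:
  fixes B :: "real^'n^'n"
  assumes "v \<noteq> 0" "B *v v = r *\<^sub>R v"
  shows "complex_eigenvalue B (complex_of_real r)"
  unfolding complex_eigenvalue_def
proof (intro exI conjI)
  let ?v = "\<chi> i. complex_of_real (v $ i)"
  show "?v \<noteq> 0"
    using assms(1) by (auto simp: vec_eq_iff)
  show "map_matrix complex_of_real B *v ?v = complex_of_real r *s ?v"
  proof (subst vec_eq_iff, rule allI)
    fix i
    have "(map_matrix complex_of_real B *v ?v) $ i = complex_of_real ((B *v v) $ i)"
      by (simp add: matrix_vector_mult_def map_matrix_def)
    then show "(map_matrix complex_of_real B *v ?v) $ i = (complex_of_real r *s ?v) $ i"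
      by (simp add: assms(2))
  qed
qed

lemma invertible_iff_kernel:
  fixes B :: "real^'n^'n"
  shows "invertible B \<longleftrightarrow> (\<forall>x. B *v x = 0 \<longrightarrow> x = 0)"
  by (simp add: invertible_left_inverse matrix_left_invertible_ker)

text \<open>All eigenvalues have real part at least \<open>r > 0\<close>; in particular 0 is not
  among them.\<close>

lemma Z_matrix_pos_eigenvector_imp_M_matrix:
  fixes B :: "real^'n^'n"
  assumes Z: "Z_matrix B" and w: "pos_vec w" "B *v w = r *\<^sub>R w" and r: "0 < r"
  shows "M_matrix B" "invertible B"
proof -
  show "M_matrix B"
    using Z_matrix_eigenvalue_Re_ge[OF Z w] r Z by (force simp: M_matrix_def)
  show "invertible B"
    unfolding invertible_iff_kernel
  proof (intro allI impI, rule ccontr)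
    fix x assume "B *v x = 0" "x \<noteq> 0"
    then have "complex_eigenvalue B (complex_of_real 0)"
      by (intro complex_eigenvalue_of_real[of x]) auto
    then show False
      using Z_matrix_eigenvalue_Re_ge[OF Z w] r by fastforce
  qed
qed

text \<open>Here \<open>t\<close> is the least ratio \<open>x $ i / w $ i\<close>. The nonnegative
  vector \<open>x - t *\<^sub>R w\<close> touches zero at \<open>k\<close>, which starts the two
  comparison arguments that follow.\<close>

lemma ex_min_ratio:
  fixes x w :: "real^'n"
  assumes "pos_vec w"
  obtains t k where "\<And>i. t * w $ i \<le> x $ i" "x $ k = t * w $ k"
proof -
  define q where "q i = x $ i / w $ i" for i
  have "Min (range q) \<in> range q"
    by (intro Min_in) auto
  then obtain k where "Min (range q) = q k"
    by blast
  then have k: "q k \<le> q i" for i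
    using Min_le[of "range q" "q i"] by simp
  show ?thesis
  proof (rule that[of "q k" k])
    show "q k * w $ i \<le> x $ i" for i
      using k[of i] assms by (simp add: q_def pos_vec_def pos_le_divide_eq)
    show "x $ k = q k * w $ k"
      using assms by (simp add: q_def pos_vec_def less_imp_neq[symmetric])
  qed
qed

text \<open>At the index \<open>k\<close> where \<open>x\<close> touches
  \<open>t *\<^sub>R w\<close>, the Z-pattern gives
  \<open>(B *v x) $ k \<le> t * (B *v w) $ k\<close>. Thus \<open>t \<ge> 0\<close> and
  \<open>x \<ge> 0\<close>, and the dichotomy gives strictness.\<close>

lemma Z_matrix_inverse_positive:
  fixes B :: "real^'n^'n"
  assumes Z: "Z_matrix B" and irr: "irreducible_matrix B"
    and w: "pos_vec w" "\<And>i. 0 < (B *v w) $ i"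
    and x: "\<And>i. 0 \<le> (B *v x) $ i" "B *v x \<noteq> 0"
  shows "pos_vec x"
proof -
  obtain t k where t: "\<And>i. t * w $ i \<le> x $ i" "x $ k = t * w $ k"
    using ex_min_ratio[OF w(1)] by blast
  have "(B *v x) $ k - t * (B *v w) $ k = (\<Sum>j\<in>UNIV. B $ k $ j * (x $ j - t * w $ j))"
    by (simp add: matrix_vector_mult_def sum_distrib_left right_diff_distrib sum_subtractf mult_ac)
  also have "\<dots> \<le> 0"
  proof (rule sum_nonpos)
    fix j
    show "B $ k $ j * (x $ j - t * w $ j) \<le> 0"
      using t Z by (cases "j = k") (auto simp: Z_matrix_def mult_nonpos_nonneg)
  qed
  finally have "0 \<le> t * (B *v w) $ k"
    using x(1)[of k] by simp
  then have "0 \<le> t"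
    using w(2)[of k] by (simp add: zero_le_mult_iff)
  then have "0 \<le> x $ i" for i
    using t(1)[of i] w(1) by (metis mult_nonneg_nonneg order_trans pos_vec_def less_imp_le)
  moreover have "x \<noteq> 0"
    using x(2) by auto
  ultimately show ?thesis
    using irreducible_Z_matrix_zero_or_pos[OF Z irr] x(1) by blast
qed

text \<open>The difference \<open>x - t *\<^sub>R w\<close> is a nonnegative kernel vector with a
  zero entry, so the dichotomy makes it zero.\<close>

lemma irreducible_Z_matrix_kernel_unique:
  fixes B :: "real^'n^'n"
  assumes Z: "Z_matrix B" and irr: "irreducible_matrix B"
    and w: "pos_vec w" "B *v w = 0" and x: "B *v x = 0"
  obtains t where "x = t *\<^sub>R w"
proof -
  obtain t k where t: "\<And>i. t * w $ i \<le> x $ i" "x $ k = t * w $ k"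
    using ex_min_ratio[OF w(1)] by blast
  have "B *v (x - t *\<^sub>R w) = 0"
    by (simp add: matrix_vector_mult_diff_distrib matrix_vector_mult_scaleR w x)
  then have "x - t *\<^sub>R w = 0 \<or> pos_vec (x - t *\<^sub>R w)"
    using t by (intro irreducible_Z_matrix_zero_or_pos[OF Z irr]) auto
  moreover have "\<not> pos_vec (x - t *\<^sub>R w)"
    using t(2) by (auto simp: pos_vec_def intro!: exI[of _ k])
  ultimately show ?thesis
    using that[of t] by simp
qed

text \<open>With \<open>d\<^sub>i = w\<^sub>i y\<^sub>i\<close>, the quadratic form is
  \<open>\<Sum>\<^sub>i y\<^sub>i\<^sup>2 w\<^sub>i (H w)\<^sub>i - 1/2 \<Sum>\<^sub>i\<^sub>j H\<^sub>i\<^sub>j w\<^sub>i w\<^sub>j (y\<^sub>i - y\<^sub>j)\<^sup>2\<close>.\<close>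

lemma symmetric_Z_matrix_pos_def:
  fixes H :: "real^'n^'n"
  assumes sym: "transpose H = H" and Z: "Z_matrix H" and irr: "irreducible_matrix H"
    and w: "pos_vec w" and Hw: "\<And>i. 0 \<le> (H *v w) $ i" "H *v w \<noteq> 0"
    and d: "d \<noteq> 0"
  shows "0 < d \<bullet> (H *v d)"
proof -
  define y where "y i = d $ i / w $ i" for i
  have wpos: "0 < w $ i" for i
    using w by (simp add: pos_vec_def)
  have dy: "d $ i = w $ i * y i" for i
    using wpos[of i] by (simp add: y_def)
  have Hsym: "H $ i $ j = H $ j $ i" for i j
    using sym by (metis transpose_def vec_lambda_beta)
  define c where "c i j = - (H $ i $ j * w $ i * w $ j * (y i - y j)\<^sup>2)" for i j
  have c: "0 \<le> c i j" for i j
    using Z wpos[of i] wpos[of j] unfolding c_def Z_matrix_def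
    by (cases "i = j") (auto simp: mult_nonpos_nonneg)
  define e where "e i = (y i)\<^sup>2 * w $ i * (H *v w) $ i" for i
  have e: "0 \<le> e i" for i
    using Hw(1)[of i] wpos[of i] by (simp add: e_def)
  have e': "e i = (\<Sum>j\<in>UNIV. H $ i $ j * w $ i * w $ j * (y i)\<^sup>2)" for i
    by (simp add: e_def matrix_vector_mult_def sum_distrib_left mult_ac)
  have e'': "(\<Sum>i\<in>UNIV. e i) = (\<Sum>i\<in>UNIV. \<Sum>j\<in>UNIV. H $ i $ j * w $ i * w $ j * (y j)\<^sup>2)"
    unfolding e' by (subst sum.swap) (simp add: Hsym mult_ac cong: sum.cong)
  have q: "d \<bullet> (H *v d) = (\<Sum>i\<in>UNIV. \<Sum>j\<in>UNIV. H $ i $ j * w $ i * w $ j * y i * y j)"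
    by (simp add: inner_vec_def matrix_vector_mult_def dy sum_distrib_left mult_ac)
  have "2 * (d \<bullet> (H *v d))
      = (\<Sum>i\<in>UNIV. \<Sum>j\<in>UNIV. H $ i $ j * w $ i * w $ j * (y i)\<^sup>2
          + H $ i $ j * w $ i * w $ j * (y j)\<^sup>2 + c i j)"
    unfolding q sum_distrib_left
    by (intro sum.cong refl) (simp add: c_def power2_eq_square algebra_simps)
  also have "\<dots> = 2 * (\<Sum>i\<in>UNIV. e i) + (\<Sum>i\<in>UNIV. \<Sum>j\<in>UNIV. c i j)"
    using e'' by (simp add: sum.distrib e')
  finally have eq: "2 * (d \<bullet> (H *v d)) = 2 * (\<Sum>i\<in>UNIV. e i) + (\<Sum>i\<in>UNIV. \<Sum>j\<in>UNIV. c i j)" .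
  have E: "0 \<le> (\<Sum>i\<in>UNIV. e i)" and C: "0 \<le> (\<Sum>i\<in>UNIV. \<Sum>j\<in>UNIV. c i j)"
    using e c by (auto intro!: sum_nonneg)
  \<comment> \<open>Otherwise all \<open>e i\<close> and \<open>c i j\<close> vanish. The former
    yield an index with \<open>y k = 0\<close>, the latter forbid entries of \<open>H\<close>
    between zeros and nonzeros of \<open>y\<close>; irreducibility then spreads the zero to every
    index.\<close>
  have "\<not> d \<bullet> (H *v d) \<le> 0"
  proof
    assume "d \<bullet> (H *v d) \<le> 0"
    then have e0: "(\<Sum>i\<in>UNIV. e i) = 0" and c0: "(\<Sum>i\<in>UNIV. \<Sum>j\<in>UNIV. c i j) = 0"
      using eq E C by auto
    have ei: "e i = 0" for i
      using e0 e by (subst (asm) sum_nonneg_eq_0_iff) auto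
    have cij: "c i j = 0" for i j
    proof -
      have "(\<Sum>j\<in>UNIV. c i j) = 0"
        using c0 c by (subst (asm) sum_nonneg_eq_0_iff) (auto intro!: sum_nonneg)
      then show ?thesis
        using c by (subst (asm) sum_nonneg_eq_0_iff) auto
    qed
    obtain k where k: "(H *v w) $ k \<noteq> 0"
      using Hw(2) by (auto simp: vec_eq_iff)
    then have yk: "y k = 0"
      using ei[of k] wpos[of k] by (simp add: e_def)
    define S where "S = {i. y i = 0}"
    have "H $ i $ j = 0" if "i \<in> S" "j \<in> - S" for i j
      using cij[of i j] that wpos[of i] wpos[of j] by (auto simp: c_def S_def)
    moreover have "S \<noteq> {}"
      using yk by (auto simp: S_def)
    ultimately have "S = UNIV"
      using irr unfolding irreducible_matrix_def by blast
    then have "d = 0"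
      by (auto simp: S_def vec_eq_iff dy)
    then show False
      using d by simp
  qed
  then show ?thesis
    by simp
qed

section \<open>Diagonal matrices and inverses\<close>

lemma diag_mat_matrix_mult_nth: "(diag_mat x ** A) $ i $ j = x $ i * A $ i $ j"
proof -
  have "(\<Sum>k\<in>UNIV. (if i = k then x $ i else 0) * A $ k $ j)
      = (\<Sum>k\<in>UNIV. if k = i then x $ i * A $ i $ j else 0)"
    by (intro sum.cong) auto
  then show ?thesis
    by (simp add: matrix_matrix_mult_def diag_mat_def)
qed

lemma matrix_mult_diag_mat_nth: "(A ** diag_mat x) $ i $ j = A $ i $ j * x $ j"
proof -
  have "(\<Sum>k\<in>UNIV. A $ i $ k * (if k = j then x $ k else 0))
      = (\<Sum>k\<in>UNIV. if k = j then A $ i $ j * x $ j else 0)"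
    by (intro sum.cong) auto
  then show ?thesis
    by (simp add: matrix_matrix_mult_def diag_mat_def)
qed

lemma diag_mat_nth: "diag_mat x $ i $ j = (if i = j then x $ i else 0)"
  by (simp add: diag_mat_def)

lemma matrix_inv_right_left:
  fixes B :: "real^'n^'n"
  assumes "invertible B"
  shows "B ** matrix_inv B = mat 1" "matrix_inv B ** B = mat 1"
proof -
  have "B ** matrix_inv B = mat 1 \<and> matrix_inv B ** B = mat 1"
    using assms unfolding invertible_def matrix_inv_def by (rule someI_ex)
  then show "B ** matrix_inv B = mat 1" "matrix_inv B ** B = mat 1"
    by auto
qed

lemma matrix_inv_mult_eqI:
  fixes B :: "real^'n^'n"
  assumes "invertible B" "B *v x = y"
  shows "matrix_inv B *v y = x"
  using assms by (metis matrix_inv_right_left(2) matrix_vector_mul_assoc matrix_vector_mul_lid)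

lemma matrix_inv_diag_mat_mult:
  fixes x y :: "real^'n"
  assumes "pos_vec x"
  shows "matrix_inv (diag_mat x) *v y = (\<chi> i. y $ i / x $ i)"
proof (rule matrix_inv_mult_eqI)
  have x: "x $ i \<noteq> 0" for i
    using assms by (simp add: pos_vec_def less_imp_neq[symmetric])
  then show "invertible (diag_mat x)"
    by (simp add: invertible_iff_kernel diag_mat_mult_vec vec_eq_iff)
  show "diag_mat x *v (\<chi> i. y $ i / x $ i) = y"
    using x by (simp add: diag_mat_mult_vec vec_eq_iff)
qed

lemma inner_matrix_vector_mult_symmetric:
  fixes A :: "real^'n^'n"
  assumes "transpose A = A"
  shows "x \<bullet> (A *v y) = (A *v x) \<bullet> y"
  by (metis assms dot_lmul_matrix transpose_matrix_vector)

text \<open>Pairing with the positive left eigenvector gives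
  \<open>r * (l \<bullet> x) = l \<bullet> (B *v x) > 0\<close>. A weak positive supersolution
  \<open>x\<close> is thereby upgraded to the strict one \<open>w\<close>.\<close>

lemma irreducible_Z_matrix_semipositive:
  fixes B :: "real^'n^'n"
  assumes Z: "Z_matrix B" and irr: "irreducible_matrix B"
    and x: "pos_vec x" "\<And>i. 0 \<le> (B *v x) $ i" "B *v x \<noteq> 0"
  obtains r w where "0 < r" "pos_vec w" "B *v w = r *\<^sub>R w"
proof -
  obtain r w l where w: "pos_vec w" "B *v w = r *\<^sub>R w"
    and l: "pos_vec l" "\<And>x. l \<bullet> (B *v x) = r * (l \<bullet> x)"
    using irreducible_Z_matrix_perron[OF Z irr] by metis
  have "0 < r * (l \<bullet> x)"
    using inner_pos_vec_pos[OF l(1) x(2,3)] l(2) by simp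
  moreover have "0 < l \<bullet> x"
    using inner_pos_vec_pos[OF l(1), of x] x(1) pos_vec_neq_0[OF x(1)]
    by (auto simp: pos_vec_def less_imp_le)
  ultimately have "0 < r"
    by (simp add: zero_less_mult_iff)
  then show ?thesis
    using that w by blast
qed

text \<open>The vector \<open>x\<close> makes \<open>B\<close> inverse-positive, so
  \<open>B *v (- y) \<ge> 0\<close> would force \<open>- y\<close> to be positive.\<close>

lemma irreducible_Z_matrix_no_null_pos_vec:
  fixes B :: "real^'n^'n"
  assumes Z: "Z_matrix B" and irr: "irreducible_matrix B"
    and x: "pos_vec x" "\<And>i. 0 \<le> (B *v x) $ i" "B *v x \<noteq> 0"
    and y: "pos_vec y" "\<And>i. (B *v y) $ i \<le> 0"
  shows False
proof -
  obtain r w where w: "0 < r" "pos_vec w" "B *v w = r *\<^sub>R w"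
    by (rule irreducible_Z_matrix_semipositive[OF Z irr x])
  then have Bw: "0 < (B *v w) $ i" for i
    by (simp add: pos_vec_def)
  have inv: "invertible B"
    using Z_matrix_pos_eigenvector_imp_M_matrix[OF Z w(2,3,1)] by simp
  have neg: "B *v (- y) = - (B *v y)"
    by (metis diff_0 matrix_vector_mult_0_right matrix_vector_mult_diff_distrib)
  have "B *v (- y) \<noteq> 0"
    using inv pos_vec_neq_0[OF y(1)] unfolding invertible_iff_kernel by force
  moreover have "0 \<le> (B *v (- y)) $ i" for i
    using y(2)[of i] by (simp add: neg)
  ultimately have "pos_vec (- y)"
    using Z_matrix_inverse_positive[OF Z irr w(2) Bw] by blast
  with y(1) show False
    by (auto simp: pos_vec_def dest: less_asym)
qed

section \<open>The power map of a grid\<close>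

text \<open>\<open>A\<close> and \<open>b\<close> stand for \<open>Y\<^sub>L\<^sub>L\<close> and \<open>I\<^sub>L\<^sup>*\<close>, the maps \<open>pw\<close> and \<open>gm\<close> for \<open>P\<^sub>c\<close> and \<open>g\<close>, and \<open>neg_jac V\<close> for
  minus the Jacobian of \<open>P\<^sub>c\<close> at \<open>V\<close>. The relation \<open>crit V m\<close> expresses \<open>m \<in> M\<close> and \<open>V = \<psi>(m)\<close>.\<close>

locale power_grid =
  fixes A :: "real^'n^'n" and b :: "real^'n"
  assumes A_sym: "transpose A = A" and A_Z: "Z_matrix A" and A_irr: "irreducible_matrix A"
    and A_one: "0 \<le> (A *v 1) $ i" "A *v 1 \<noteq> 0"
    and b_nonneg: "0 \<le> b $ i" and b_neq_0: "b \<noteq> 0"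
begin

definition pw :: "real^'n \<Rightarrow> real^'n" where
  "pw V = (\<chi> i. V $ i * (b $ i - (A *v V) $ i))"

definition neg_jac :: "real^'n \<Rightarrow> real^'n^'n" where
  "neg_jac V = diag_mat V ** A + diag_mat (A *v V - b)"

definition gm :: "real^'n \<Rightarrow> real^'n^'n" where
  "gm m = diag_mat m ** A + diag_mat (A *v m)"

definition crit :: "real^'n \<Rightarrow> real^'n \<Rightarrow> bool" where
  "crit V m \<longleftrightarrow> pos_vec V \<and> pos_vec m \<and> neg_jac V *v m = 0"

definition feas :: "(real^'n) set" where
  "feas = pw ` {V. pos_vec V}"

text \<open>This is the set \<open>D\<close> in the form of a strict supersolution condition, which
  is visibly open; \<open>stable_eq\<close> gives the agreement with the sign condition on the
  inverse Jacobian.\<close>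

definition stable :: "(real^'n) set" where
  "stable = {V. pos_vec V \<and> (\<exists>w. pos_vec w \<and> (\<forall>i. 0 < (neg_jac V *v w) $ i))}"

lemma neg_jac_mult: "(neg_jac V *v w) $ i = V $ i * (A *v w) $ i + w $ i * ((A *v V) $ i - b $ i)"
  by (simp add: neg_jac_def matrix_vector_mult_add_rdistrib diag_mat_mult_vec
      flip: matrix_vector_mul_assoc)

lemma gm_mult: "(gm m *v V) $ i = m $ i * (A *v V) $ i + V $ i * (A *v m) $ i"
  by (simp add: gm_def matrix_vector_mult_add_rdistrib diag_mat_mult_vec
      flip: matrix_vector_mul_assoc)

text \<open>This exchange of the roles of \<open>V\<close> and \<open>m\<close> turns null vectors
  of the Jacobian into solutions of the equation defining \<open>\<psi>\<close>.\<close>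

lemma neg_jac_mult_gm: "neg_jac V *v m = gm m *v V - diag_mat m *v b"
  by (simp add: vec_eq_iff neg_jac_mult gm_mult diag_mat_mult_vec algebra_simps)

lemma crit_iff_gm: "crit V m \<longleftrightarrow> pos_vec V \<and> pos_vec m \<and> gm m *v V = diag_mat m *v b"
  by (simp add: crit_def neg_jac_mult_gm)

lemma diag_mult_b:
  assumes "pos_vec m"
  shows "0 \<le> (diag_mat m *v b) $ i" "diag_mat m *v b \<noteq> 0"
  using assms b_nonneg[of i] b_neq_0
  by (auto simp: diag_mat_mult_vec pos_vec_def vec_eq_iff less_imp_le less_imp_neq[symmetric])

lemma neg_jac_offdiag: "i \<noteq> j \<Longrightarrow> neg_jac V $ i $ j = V $ i * A $ i $ j"
  by (simp add: neg_jac_def diag_mat_matrix_mult_nth diag_mat_nth)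

lemma gm_offdiag: "i \<noteq> j \<Longrightarrow> gm m $ i $ j = m $ i * A $ i $ j"
  by (simp add: gm_def diag_mat_matrix_mult_nth diag_mat_nth)

lemma
  assumes "pos_vec V"
  shows neg_jac_Z: "Z_matrix (neg_jac V)" and neg_jac_irr: "irreducible_matrix (neg_jac V)"
    and gm_Z: "Z_matrix (gm V)" and gm_irr: "irreducible_matrix (gm V)"
proof -
  have V: "0 < V $ i" for i
    using assms by (simp add: pos_vec_def)
  show "Z_matrix (neg_jac V)" "Z_matrix (gm V)"
    using A_Z V by (auto simp: Z_matrix_def neg_jac_offdiag gm_offdiag mult_nonneg_nonpos less_imp_le)
  show "irreducible_matrix (neg_jac V)" "irreducible_matrix (gm V)"
    using V by (auto intro!: irreducible_matrix_cong[OF A_irr]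
        simp: neg_jac_offdiag gm_offdiag less_imp_neq[symmetric])
qed

lemma pos_vec_one: "pos_vec (1 :: real^'n)"
  by (simp add: pos_vec_def)

lemma A_pos_def: "d \<noteq> 0 \<Longrightarrow> 0 < d \<bullet> (A *v d)"
  by (rule symmetric_Z_matrix_pos_def[OF A_sym A_Z A_irr pos_vec_one A_one])

lemma A_invertible: "invertible A"
  unfolding invertible_iff_kernel using A_pos_def by (metis inner_zero_right less_irrefl)

lemma crit_mult:
  assumes "crit V m" "0 < t"
  shows "crit V (t *\<^sub>R m)"
  using assms by (auto simp: crit_def pos_vec_def matrix_vector_mult_scaleR)

lemma crit_unique_up_to_scale:
  assumes "crit V m" "crit V m'"
  obtains t where "m' = t *\<^sub>R m"
  using assms irreducible_Z_matrix_kernel_unique[OF neg_jac_Z neg_jac_irr]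
  unfolding crit_def by metis

text \<open>The dichotomy applies to \<open>A\<close> since \<open>b \<ge> 0\<close>, and
  \<open>V = 0\<close> would give \<open>b = 0\<close>. It keeps limits and maximisers off the
  boundary of the orthant.\<close>

lemma pos_vec_limit:
  assumes V: "\<And>i. 0 \<le> V $ i" and "\<And>i. V $ i = 0 \<Longrightarrow> b $ i \<le> (A *v V) $ i"
  shows "pos_vec V"
proof -
  have "0 \<le> (A *v V) $ i" if "V $ i = 0" for i
    using assms(2)[OF that] b_nonneg[of i] by simp
  then have "V = 0 \<or> pos_vec V"
    using irreducible_Z_matrix_zero_or_pos[OF A_Z A_irr V] by blast
  moreover have "V \<noteq> 0"
  proof
    assume "V = 0"
    then have "b $ i = 0" for i
      using assms(2)[of i] b_nonneg[of i] by simp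
    then have "b = 0"
      by (simp add: vec_eq_iff)
    with b_neq_0 show False ..
  qed
  ultimately show ?thesis
    by simp
qed

section \<open>The stable region and its boundary\<close>

lemma continuous_on_mult_nth: "continuous_on S (\<lambda>V. (A *v V) $ i)"
  by (intro continuous_intros linear_continuous_on matrix_vector_mul_bounded_linear)

lemma continuous_on_neg_jac: "continuous_on S (\<lambda>V. (neg_jac V *v w) $ i)"
  unfolding neg_jac_mult by (intro continuous_intros continuous_on_mult_nth)

lemma continuous_on_pw_nth: "continuous_on S (\<lambda>V. pw V $ i)"
  unfolding pw_def vec_lambda_beta by (intro continuous_intros continuous_on_mult_nth)

lemma continuous_on_pw: "continuous_on S pw"
  unfolding pw_def by (intro continuous_intros continuous_on_mult_nth)

lemma open_stable: "open stable"
proof -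
  have "stable = (\<Inter>i. {V. 0 < V $ i}) \<inter> (\<Union>w\<in>{w. pos_vec w}. \<Inter>i. {V. 0 < (neg_jac V *v w) $ i})"
    by (auto simp: stable_def pos_vec_def)
  also have "open \<dots>"
    by (intro open_Int open_UN ballI open_INT finite open_Collect_less continuous_intros
        continuous_on_neg_jac)
  finally show ?thesis .
qed

text \<open>At a stable \<open>V\<close> the diagonal of \<open>neg_jac V\<close> is positive,
  because off-diagonal entries only lower \<open>neg_jac V *v w\<close>. Nonnegativity of the
  diagonal no longer mentions \<open>w\<close> and survives limits; at a zero entry of
  \<open>V\<close> it is the hypothesis of \<open>pos_vec_limit\<close>.\<close>

lemma closure_stable_pos:
  assumes "V \<in> closure stable"
  shows "pos_vec V"
proof (rule pos_vec_limit)
  fix i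
  define E where "E = {V. 0 \<le> V $ i} \<inter> {V. 0 \<le> V $ i * A $ i $ i + ((A *v V) $ i - b $ i)}"
  have "closed E"
    unfolding E_def
    by (intro closed_Int closed_Collect_le continuous_intros continuous_on_mult_nth)
  moreover have "stable \<subseteq> E"
  proof
    fix V assume "V \<in> stable"
    then obtain w where V: "pos_vec V" and w: "pos_vec w" "0 < (neg_jac V *v w) $ i"
      by (auto simp: stable_def)
    have "(A *v w) $ i \<le> A $ i $ i * w $ i"
    proof -
      have "(\<Sum>j\<in>UNIV - {i}. A $ i $ j * w $ j) \<le> 0"
        using A_Z w(1) by (intro sum_nonpos) (auto simp: Z_matrix_def pos_vec_def mult_nonpos_nonneg less_imp_le)
      moreover have "(A *v w) $ i = A $ i $ i * w $ i + (\<Sum>j\<in>UNIV - {i}. A $ i $ j * w $ j)"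
        unfolding matrix_vector_mult_def by (simp add: sum.remove[of _ i])
      ultimately show ?thesis
        by simp
    qed
    then have "V $ i * (A *v w) $ i \<le> V $ i * (A $ i $ i * w $ i)"
      using V by (intro mult_left_mono) (auto simp: pos_vec_def less_imp_le)
    then have "0 < w $ i * (V $ i * A $ i $ i + ((A *v V) $ i - b $ i))"
      using w(2) by (simp add: neg_jac_mult algebra_simps)
    then show "V \<in> E"
      using w(1) V by (auto simp: E_def pos_vec_def zero_less_mult_iff less_imp_le dest: less_asym)
  qed
  ultimately have "V \<in> E"
    using assms closure_minimal by blast
  then show "0 \<le> V $ i" "V $ i = 0 \<Longrightarrow> b $ i \<le> (A *v V) $ i"
    by (auto simp: E_def)
qed

text \<open>Scaling \<open>V\<close> affects only the term \<open>gm m *v V\<close> of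
  \<open>neg_jac_mult_gm\<close>, leaving \<open>(t - 1) *\<^sub>R (diag_mat m *v b)\<close>, which
  is nonnegative and nonzero.\<close>

lemma crit_scaled_stable:
  assumes "crit V m" "1 < t"
  shows "t *\<^sub>R V \<in> stable"
proof -
  have V: "pos_vec V" "pos_vec m" and gV: "gm m *v V = diag_mat m *v b"
    using assms(1) by (auto simp: crit_iff_gm)
  have tV: "pos_vec (t *\<^sub>R V)"
    using V(1) assms(2) by (simp add: pos_vec_def)
  have "neg_jac (t *\<^sub>R V) *v m = (t - 1) *\<^sub>R (diag_mat m *v b)"
    by (simp add: neg_jac_mult_gm matrix_vector_mult_scaleR gV algebra_simps)
  then have "0 \<le> (neg_jac (t *\<^sub>R V) *v m) $ i" "neg_jac (t *\<^sub>R V) *v m \<noteq> 0" for i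
    using diag_mult_b[OF V(2)] assms(2) by auto
  then obtain r w where "0 < r" "pos_vec w" "neg_jac (t *\<^sub>R V) *v w = r *\<^sub>R w"
    using irreducible_Z_matrix_semipositive[OF neg_jac_Z[OF tV] neg_jac_irr[OF tV] V(2)] by metis
  then show ?thesis
    using tV by (auto simp: stable_def pos_vec_def intro!: exI[of _ w])
qed

text \<open>The eigenvalue \<open>r\<close> of a positive eigenvector of \<open>neg_jac V\<close>
  decides: positive means stable, negative excludes stable points nearby, so a boundary point has
  \<open>r = 0\<close>. Conversely, a critical \<open>V\<close> is not stable but is the limit of
  its stable multiples.\<close>

lemma frontier_stable: "V \<in> frontier stable \<longleftrightarrow> (\<exists>m. crit V m)"
proof
  assume "V \<in> frontier stable"
  then have V: "V \<in> closure stable" "V \<notin> stable"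
    using open_stable by (auto simp: frontier_def interior_open)
  have pos: "pos_vec V"
    by (rule closure_stable_pos[OF V(1)])
  obtain r w where w: "pos_vec w" "neg_jac V *v w = r *\<^sub>R w"
    by (rule irreducible_Z_matrix_eigenvector[OF neg_jac_Z[OF pos] neg_jac_irr[OF pos]])
  have "\<not> 0 < r"
    using V(2) pos w by (auto simp: stable_def pos_vec_def)
  moreover have "\<not> r < 0"
  proof
    assume r: "r < 0"
    \<comment> \<open>Keeping the eigenvector \<open>w\<close> of \<open>V\<close> fixed makes
      negativity an open condition on the nearby point.\<close>
    define U where "U = (\<Inter>i. {V. (neg_jac V *v w) $ i < 0})"
    have "open U"
      unfolding U_def
      by (intro open_INT ballI finite open_Collect_less continuous_intros continuous_on_neg_jac)
    moreover have "V \<in> U"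
      using w r by (auto simp: U_def pos_vec_def mult_neg_pos)
    ultimately obtain V' where V': "V' \<in> U" "V' \<in> stable"
      using V(1) open_Int_closure_eq_empty[of U stable] by auto
    then obtain x where x: "pos_vec V'" "pos_vec x" "\<And>i. 0 < (neg_jac V' *v x) $ i"
      by (auto simp: stable_def)
    have "neg_jac V' *v x \<noteq> 0"
      using x(3) by (metis less_irrefl zero_index)
    then show False
      using irreducible_Z_matrix_no_null_pos_vec[OF neg_jac_Z[OF x(1)] neg_jac_irr[OF x(1)] x(2) _ _ w(1)]
        x(3) V'(1) by (auto simp: U_def less_imp_le)
  qed
  ultimately show "\<exists>m. crit V m"
    using pos w by (auto simp: crit_def intro!: exI[of _ w])
next
  assume "\<exists>m. crit V m"
  then obtain m where m: "crit V m"
    by blast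
  then have pos: "pos_vec V" "pos_vec m" and null: "neg_jac V *v m = 0"
    by (auto simp: crit_def)
  have "V \<notin> stable"
  proof
    assume "V \<in> stable"
    then obtain x where x: "pos_vec x" "\<And>i. 0 < (neg_jac V *v x) $ i"
      by (auto simp: stable_def)
    have "neg_jac V *v x \<noteq> 0"
      using x(2) by (metis less_irrefl zero_index)
    then show False
      using irreducible_Z_matrix_no_null_pos_vec[OF neg_jac_Z[OF pos(1)] neg_jac_irr[OF pos(1)] x(1) _ _ pos(2)]
        x(2) null by (auto simp: less_imp_le)
  qed
  moreover have "V \<in> closure stable"
    unfolding closure_sequential
  proof (intro exI conjI allI)
    show "(1 + 1 / real (Suc k)) *\<^sub>R V \<in> stable" for k
      by (rule crit_scaled_stable[OF m]) simp
    have "(\<lambda>k. (1 + 1 / real (Suc k)) *\<^sub>R V) \<longlonglongrightarrow> (1 + 0) *\<^sub>R V"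
      by (intro tendsto_intros LIMSEQ_Suc[OF lim_1_over_n])
    then show "(\<lambda>k. (1 + 1 / real (Suc k)) *\<^sub>R V) \<longlonglongrightarrow> V"
      by simp
  qed
  ultimately show "V \<in> frontier stable"
    using open_stable by (simp add: frontier_def interior_open)
qed

section \<open>Exact expansion of the power map and maximality at critical points\<close>

lemma pw_add: "pw (V + d) $ i = pw V $ i - (neg_jac V *v d) $ i - d $ i * (A *v d) $ i"
  by (simp add: pw_def neg_jac_mult matrix_vector_right_distrib algebra_simps)

text \<open>A left null vector \<open>l > 0\<close> of \<open>neg_jac V\<close> turns the expansion of \<open>pw\<close> around \<open>V\<close> into
  \<open>l \<bullet> pw (V + d) = l \<bullet> pw V - 1/2 d \<bullet> H d\<close>, where \<open>H = [l]A + A[l]\<close> is positive definite because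
  \<open>H V = [l]b\<close>.\<close>

lemma crit_pw_maximal:
  assumes "crit V m" and ge: "\<And>i. pw V $ i \<le> pw U $ i"
  shows "U = V"
proof (rule ccontr)
  assume "U \<noteq> V"
  define d where "d = U - V"
  have d: "d \<noteq> 0" and U: "U = V + d"
    using \<open>U \<noteq> V\<close> by (auto simp: d_def)
  have V: "pos_vec V" "pos_vec m" "neg_jac V *v m = 0"
    using assms(1) by (auto simp: crit_def)
  obtain r w l where w: "pos_vec w" "neg_jac V *v w = r *\<^sub>R w"
    and l: "pos_vec l" "\<And>x. l \<bullet> (neg_jac V *v x) = r * (l \<bullet> x)"
    using irreducible_Z_matrix_perron[OF neg_jac_Z[OF V(1)] neg_jac_irr[OF V(1)]] by metis
  \<comment> \<open>Pairing \<open>l\<close> with the positive null vector \<open>m\<close> forces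
    the common eigenvalue \<open>r\<close> to be 0.\<close>
  have "0 < l \<bullet> m"
    using inner_pos_vec_pos[OF l(1), of m] V(2) pos_vec_neq_0[OF V(2)]
    by (auto simp: pos_vec_def less_imp_le)
  then have "r = 0"
    using l(2)[of m] V(3) by simp
  then have null: "l \<bullet> (neg_jac V *v x) = 0" for x
    using l(2) by simp
  \<comment> \<open>This is \<open>transpose (neg_jac V) *v l\<close>, so \<open>u = 0\<close>
    restates the left null property as an equation for \<open>H *v V\<close>.\<close>
  define u where "u = A *v (diag_mat l *v V) + diag_mat l *v (A *v V) - diag_mat l *v b"
  have "u \<bullet> x = 0" for x
  proof -
    have "u \<bullet> x = (diag_mat l *v V) \<bullet> (A *v x) + (diag_mat l *v (A *v V) - diag_mat l *v b) \<bullet> x"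
      by (simp add: u_def inner_matrix_vector_mult_symmetric[OF A_sym] inner_simps)
    also have "\<dots> = l \<bullet> (neg_jac V *v x)"
      by (simp add: inner_vec_def diag_mat_mult_vec neg_jac_mult sum.distrib[symmetric] algebra_simps)
    finally show ?thesis
      by (simp add: null)
  qed
  then have u: "u = 0"
    by (metis inner_eq_zero_iff)
  define H where "H = diag_mat l ** A + A ** diag_mat l"
  have H: "H *v x = diag_mat l *v (A *v x) + A *v (diag_mat l *v x)" for x
    by (simp add: H_def matrix_vector_mult_add_rdistrib matrix_vector_mul_assoc)
  have Hij: "H $ i $ j = (l $ i + l $ j) * A $ i $ j" for i j
    by (simp add: H_def diag_mat_matrix_mult_nth matrix_mult_diag_mat_nth algebra_simps)
  have lpos: "0 < l $ i + l $ j" for i j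
    using l(1) by (simp add: pos_vec_def add_pos_pos)
  have HV: "H *v V = diag_mat l *v b"
    using u by (simp add: H u_def algebra_simps)
  have Asym: "A $ i $ j = A $ j $ i" for i j
    using A_sym by (metis transpose_def vec_lambda_beta)
  have "transpose H = H"
    by (simp add: vec_eq_iff transpose_def Hij Asym add.commute)
  moreover have "Z_matrix H"
    using A_Z lpos by (simp add: Z_matrix_def Hij mult_nonneg_nonpos less_imp_le)
  moreover have "irreducible_matrix H"
    using lpos by (intro irreducible_matrix_cong[OF A_irr]) (auto simp: Hij less_imp_neq[symmetric])
  ultimately have "0 < d \<bullet> (H *v d)"
    by (rule symmetric_Z_matrix_pos_def[OF _ _ _ V(1)]) (use HV diag_mult_b[OF l(1)] d in auto)
  also have "d \<bullet> (H *v d) = d \<bullet> (diag_mat l *v (A *v d)) + (A *v d) \<bullet> (diag_mat l *v d)"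
    by (simp add: H inner_add_right inner_matrix_vector_mult_symmetric[OF A_sym])
  also have "\<dots> = 2 * (\<Sum>i\<in>UNIV. l $ i * (d $ i * (A *v d) $ i))"
    by (simp add: inner_vec_def diag_mat_mult_vec sum_distrib_left sum.distrib[symmetric] algebra_simps)
  also have "\<dots> = 2 * (l \<bullet> pw V - l \<bullet> (neg_jac V *v d) - l \<bullet> pw U)"
    by (simp add: inner_vec_def U pw_add sum_subtractf[symmetric] algebra_simps)
  finally have "l \<bullet> pw U < l \<bullet> pw V"
    by (simp add: null)
  moreover have "l \<bullet> pw V \<le> l \<bullet> pw U"
    unfolding inner_vec_def using ge l(1)
    by (auto intro!: sum_mono mult_left_mono simp: pos_vec_def less_imp_le)
  ultimately show False
    by simp
qed

section \<open>The feasible set\<close>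

lemma A_coercive: "\<exists>k>0. \<forall>x. k * (norm x)\<^sup>2 \<le> x \<bullet> (A *v x)"
proof -
  have "continuous_on (sphere 0 1) (\<lambda>x. x \<bullet> (A *v x))"
    by (intro continuous_intros linear_continuous_on matrix_vector_mul_bounded_linear)
  moreover have "axis undefined 1 \<in> sphere (0 :: real^'n) 1"
    by (simp add: norm_axis_1)
  then have "sphere (0 :: real^'n) 1 \<noteq> {}"
    by blast
  ultimately have "\<exists>u\<in>sphere 0 1. \<forall>x\<in>sphere 0 1. u \<bullet> (A *v u) \<le> x \<bullet> (A *v x)"
    by (intro continuous_attains_inf compact_sphere)
  then obtain u where u: "u \<in> sphere 0 1" "\<And>x. x \<in> sphere 0 1 \<Longrightarrow> u \<bullet> (A *v u) \<le> x \<bullet> (A *v x)"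
    by blast
  have "u \<bullet> (A *v u) * (norm x)\<^sup>2 \<le> x \<bullet> (A *v x)" for x
  proof (cases "x = 0")
    case False
    define y where "y = (1 / norm x) *\<^sub>R x"
    have "y \<in> sphere 0 1" and x: "x = norm x *\<^sub>R y"
      using False by (auto simp: y_def)
    have "x \<bullet> (A *v x) = (norm x)\<^sup>2 * (y \<bullet> (A *v y))"
      by (subst (1 2) x) (simp add: matrix_vector_mult_scaleR power2_eq_square)
    then show ?thesis
      using mult_right_mono[OF u(2)[OF \<open>y \<in> sphere 0 1\<close>], of "(norm x)\<^sup>2"] by (simp add: mult.commute)
  qed simp
  moreover have "0 < u \<bullet> (A *v u)"
    using u(1) by (intro A_pos_def) auto
  ultimately show ?thesis
    by blast
qed

text \<open>The total power is \<open>V \<bullet> b - V \<bullet> (A *v V)\<close>, where coercivity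
  of \<open>A\<close> beats the linear term. This supplies the compactness for the maximisation and
  closedness arguments.\<close>

lemma pw_superlevel_bounded:
  obtains R where "\<And>V. - q \<le> (\<Sum>i\<in>UNIV. pw V $ i) \<Longrightarrow> norm V \<le> R"
proof -
  obtain k where k: "0 < k" "\<And>x. k * (norm x)\<^sup>2 \<le> x \<bullet> (A *v x)"
    using A_coercive by blast
  show ?thesis
  proof (rule that)
    fix V assume V: "- q \<le> (\<Sum>i\<in>UNIV. pw V $ i)"
    have "(\<Sum>i\<in>UNIV. pw V $ i) = V \<bullet> b - V \<bullet> (A *v V)"
      by (simp add: pw_def inner_vec_def algebra_simps sum_subtractf)
    then have ineq: "k * (norm V)\<^sup>2 \<le> norm V * norm b + \<bar>q\<bar>"
      using V k(2)[of V] norm_cauchy_schwarz[of V b] by linarith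
    \<comment> \<open>The summand 1 covers small \<open>V\<close>; beyond norm 1,
      \<open>\<bar>q\<bar> \<le> norm V * \<bar>q\<bar>\<close> allows a factor
      \<open>norm V\<close> to be cancelled.\<close>
    show "norm V \<le> 1 + (norm b + \<bar>q\<bar>) / k"
    proof (cases "norm V \<le> 1")
      case True
      moreover have "0 \<le> (norm b + \<bar>q\<bar>) / k"
        using k(1) by simp
      ultimately show ?thesis
        by linarith
    next
      case False
      then have "\<bar>q\<bar> \<le> norm V * \<bar>q\<bar>"
        by (simp add: mult_le_cancel_right1)
      then have "norm V * (k * norm V) \<le> norm V * (norm b + \<bar>q\<bar>)"
        using ineq by (simp add: power2_eq_square algebra_simps)
      moreover have "0 < norm V"
        using False by linarith
      ultimately have "k * norm V \<le> norm b + \<bar>q\<bar>"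
        by (simp add: mult_le_cancel_left)
      then have "norm V \<le> (norm b + \<bar>q\<bar>) / k"
        using k(1) by (simp add: pos_le_divide_eq mult.commute)
      then show ?thesis
        by simp
    qed
  qed
qed

lemma mult_add_axis: "(A *v (V + e *\<^sub>R axis i 1)) $ j = (A *v V) $ j + e * A $ j $ i"
  by (simp add: matrix_vector_right_distrib matrix_vector_mult_scaleR matrix_vector_mult_basis column_def)

text \<open>Raising one voltage increases the power at the other loads. Hence a vector of maximal total
  voltage among the nonnegative \<open>V\<close> with \<open>p \<le> pw V\<close> has \<open>pw V = p\<close> and no zero entry.\<close>

lemma feasible_if_dominated:
  assumes V0: "\<And>i. 0 \<le> V0 $ i" "\<And>i. p $ i \<le> pw V0 $ i"
  shows "p \<in> feas"
proof -
  define S where "S = {V. (\<forall>i. 0 \<le> V $ i) \<and> (\<forall>i. p $ i \<le> pw V $ i)}"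
  have "compact S"
  proof (rule compact_eq_bounded_closed[THEN iffD2], intro conjI)
    obtain R where R: "\<And>V. - (- (\<Sum>i\<in>UNIV. p $ i)) \<le> (\<Sum>i\<in>UNIV. pw V $ i) \<Longrightarrow> norm V \<le> R"
      using pw_superlevel_bounded[of "- (\<Sum>i\<in>UNIV. p $ i)"] by blast
    show "bounded S"
      unfolding bounded_iff by (intro exI[of _ R] ballI R) (auto simp: S_def intro: sum_mono)
    have "S = (\<Inter>i. {V. 0 \<le> V $ i}) \<inter> (\<Inter>i. {V. p $ i \<le> pw V $ i})"
      by (auto simp: S_def)
    also have "closed \<dots>"
      by (intro closed_Int closed_INT ballI closed_Collect_le continuous_intros continuous_on_pw_nth)
    finally show "closed S" .
  qed
  moreover have "S \<noteq> {}"
    using V0 by (auto simp: S_def)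
  moreover have "continuous_on S (\<lambda>V. \<Sum>i\<in>UNIV. V $ i)"
    by (intro continuous_intros)
  ultimately have "\<exists>V\<in>S. \<forall>U\<in>S. (\<Sum>i\<in>UNIV. U $ i) \<le> (\<Sum>i\<in>UNIV. V $ i)"
    by (rule continuous_attains_sup)
  then obtain V where V: "V \<in> S" and max: "\<And>U. U \<in> S \<Longrightarrow> (\<Sum>i\<in>UNIV. U $ i) \<le> (\<Sum>i\<in>UNIV. V $ i)"
    by blast
  have nonneg: "0 \<le> V $ i" and ge: "p $ i \<le> pw V $ i" for i
    using V by (auto simp: S_def)
  \<comment> \<open>After raising entry \<open>i\<close>, only the constraint at \<open>i\<close>
    itself can fail; if it holds, the new vector lies in \<open>S\<close> with a larger
    total.\<close>
  have no_raise: False if e: "0 < e" "p $ i \<le> pw (V + e *\<^sub>R axis i 1) $ i" for i e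
  proof -
    let ?U = "V + e *\<^sub>R axis i 1"
    have "p $ j \<le> pw ?U $ j" for j
    proof (cases "j = i")
      case False
      have "A $ j $ i \<le> 0"
        using A_Z False by (simp add: Z_matrix_def)
      then have "e * A $ j $ i \<le> 0"
        using e(1) by (simp add: mult_nonneg_nonpos)
      then have "V $ j * (b $ j - (A *v V) $ j) \<le> V $ j * (b $ j - (A *v ?U) $ j)"
        using nonneg by (intro mult_left_mono) (auto simp: mult_add_axis)
      then show ?thesis
        using ge[of j] False by (simp add: pw_def axis_def)
    qed (use e(2) in simp)
    moreover have "0 \<le> ?U $ j" for j
      using nonneg[of j] e(1) by (simp add: axis_def)
    ultimately have "(\<Sum>j\<in>UNIV. ?U $ j) \<le> (\<Sum>j\<in>UNIV. V $ j)"
      by (intro max) (simp add: S_def)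
    then show False
      using e(1) by (simp add: sum.distrib axis_def flip: sum_distrib_left)
  qed
  have pw_raise: "pw (V + e *\<^sub>R axis i 1) $ i = (V $ i + e) * (b $ i - (A *v V) $ i - e * A $ i $ i)" for e i
    unfolding pw_def vec_lambda_beta mult_add_axis by (simp add: axis_def diff_diff_eq)
  have "pw V $ i = p $ i" for i
  proof (rule ccontr)
    assume "pw V $ i \<noteq> p $ i"
    then have gt: "p $ i < pw V $ i"
      using ge[of i] by simp
    have "((\<lambda>e. pw (V + e *\<^sub>R axis i 1) $ i) \<longlongrightarrow> (V $ i + 0) * (b $ i - (A *v V) $ i - 0 * A $ i $ i)) (at_right 0)"
      unfolding pw_raise by (intro tendsto_intros)
    moreover have "p $ i < (V $ i + 0) * (b $ i - (A *v V) $ i - 0 * A $ i $ i)"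
      using gt by (simp add: pw_def)
    ultimately have "\<forall>\<^sub>F e in at_right 0. p $ i < pw (V + e *\<^sub>R axis i 1) $ i"
      by (rule order_tendstoD)
    then have "\<forall>\<^sub>F e in at_right (0::real). False"
      using eventually_at_right_less[of "0::real"]
    proof eventually_elim
      case (elim e)
      then show False
        using no_raise[of e i] by simp
    qed
    then show False
      by simp
  qed
  moreover have "pos_vec V"
  \<comment> \<open>If \<open>V $ i = 0\<close>, then \<open>p $ i \<le> 0\<close>, while raising
    entry \<open>i\<close> slightly gives a power equal to \<open>e\<close> times a positive factor;
    this contradicts \<open>no_raise\<close>.\<close>
  proof (rule pos_vec_limit[OF nonneg], rule ccontr)
    fix i assume Vi: "V $ i = 0" and "\<not> b $ i \<le> (A *v V) $ i"
    then have gt: "0 < b $ i - (A *v V) $ i - 0 * A $ i $ i"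
      by simp
    have "p $ i \<le> 0"
      using ge[of i] Vi by (simp add: pw_def)
    have "((\<lambda>e. b $ i - (A *v V) $ i - e * A $ i $ i) \<longlongrightarrow> b $ i - (A *v V) $ i - 0 * A $ i $ i) (at_right 0)"
      by (intro tendsto_intros)
    then have "\<forall>\<^sub>F e in at_right 0. 0 < b $ i - (A *v V) $ i - e * A $ i $ i"
      using gt by (rule order_tendstoD)
    then have "\<forall>\<^sub>F e in at_right (0::real). False"
      using eventually_at_right_less[of "0::real"]
    proof eventually_elim
      case (elim e)
      then have "0 \<le> pw (V + e *\<^sub>R axis i 1) $ i"
        by (simp add: pw_raise Vi)
      then show False
        using no_raise[of e i] elim(2) \<open>p $ i \<le> 0\<close> by simp
    qed
    then show False
      by simp
  qed
  ultimately show ?thesis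
    by (auto simp: feas_def vec_eq_iff intro!: image_eqI[of _ _ V])
qed

text \<open>Voltages for a convergent sequence of demands are bounded and accumulate at some
  \<open>W \<ge> 0\<close> with \<open>pw W = p\<close>. Zero entries of \<open>W\<close> are
  harmless, since \<open>feasible_if_dominated\<close> accepts nonnegative vectors.\<close>

lemma closed_feas: "closed feas"
  unfolding closed_sequential_limits
proof (intro allI impI, elim conjE)
  fix P p assume P: "\<forall>n. P n \<in> feas" and lim: "P \<longlonglongrightarrow> p"
  have "\<exists>V. \<forall>n. pos_vec (V n) \<and> P n = pw (V n)"
    using P unfolding feas_def by (intro choice) auto
  then obtain V where V: "\<And>n. pos_vec (V n)" "\<And>n. P n = pw (V n)"
    by blast
  have "(\<lambda>n. \<Sum>i\<in>UNIV. P n $ i) \<longlonglongrightarrow> (\<Sum>i\<in>UNIV. p $ i)"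
    using lim by (intro tendsto_sum tendsto_vec_nth)
  then have "convergent (\<lambda>n. \<Sum>i\<in>UNIV. P n $ i)"
    by (rule convergentI)
  then obtain q where q: "\<And>n. norm (\<Sum>i\<in>UNIV. P n $ i) \<le> q"
    using convergent_imp_Bseq BseqE by metis
  obtain R where R: "\<And>V. - q \<le> (\<Sum>i\<in>UNIV. pw V $ i) \<Longrightarrow> norm V \<le> R"
    using pw_superlevel_bounded[of q] by blast
  have "V n \<in> cball 0 R" for n
    using R[of "V n"] q[of n] by (simp add: V(2))
  then obtain W s where W: "strict_mono s" "(V \<circ> s) \<longlonglongrightarrow> W"
    using compact_cball[of "0 :: real^'n" R] unfolding compact_def by blast
  have "0 \<le> W $ i" for i
    using V(1) by (intro LIMSEQ_le_const[OF tendsto_vec_nth[OF W(2)]])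
      (auto simp: pos_vec_def less_imp_le)
  moreover have "pw W = p"
  proof (rule LIMSEQ_unique)
    show "(\<lambda>n. pw ((V \<circ> s) n)) \<longlonglongrightarrow> pw W"
      using continuous_on_tendsto_compose[OF continuous_on_pw[of UNIV] W(2)] by simp
    show "(\<lambda>n. pw ((V \<circ> s) n)) \<longlonglongrightarrow> p"
      using LIMSEQ_subseq_LIMSEQ[OF lim W(1)] by (simp add: o_def V(2))
  qed
  ultimately show "p \<in> feas"
    by (intro feasible_if_dominated[of W]) auto
qed

text \<open>Lowering demands preserves feasibility, so strict domination leaves room for a whole
  open set. Conversely, an interior point stays feasible after a small shift along the all-ones
  vector.\<close>

lemma interior_feas: "p \<in> interior feas \<longleftrightarrow> (\<exists>V. pos_vec V \<and> (\<forall>i. p $ i < pw V $ i))"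
proof
  assume "p \<in> interior feas"
  then obtain e where e: "0 < e" "ball p e \<subseteq> feas"
    using mem_interior by blast
  define c where "c = e / (2 * norm (1 :: real^'n))"
  have n1: "0 < norm (1 :: real^'n)"
    using pos_vec_neq_0[OF pos_vec_one] by simp
  then have c: "0 < c" "c * norm (1 :: real^'n) < e"
    using e(1) by (auto simp: c_def)
  then have "p + c *\<^sub>R 1 \<in> ball p e"
    by (simp add: dist_norm)
  with e(2) obtain V where V: "pos_vec V" "p + c *\<^sub>R 1 = pw V"
    by (auto simp: feas_def)
  have "p $ i < pw V $ i" for i
    using c(1) by (simp flip: V(2))
  with V(1) show "\<exists>V. pos_vec V \<and> (\<forall>i. p $ i < pw V $ i)"
    by blast
next
  assume "\<exists>V. pos_vec V \<and> (\<forall>i. p $ i < pw V $ i)"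
  then obtain V where V: "pos_vec V" "\<And>i. p $ i < pw V $ i"
    by blast
  have "open (\<Inter>i. {q. q $ i < pw V $ i})"
    by (intro open_INT ballI finite open_Collect_less continuous_intros)
  moreover have "p \<in> (\<Inter>i. {q. q $ i < pw V $ i})"
    using V(2) by simp
  moreover have "(\<Inter>i. {q. q $ i < pw V $ i}) \<subseteq> feas"
  proof
    fix q assume "q \<in> (\<Inter>i. {q. q $ i < pw V $ i})"
    then show "q \<in> feas"
      using V(1) by (intro feasible_if_dominated[of V]) (auto simp: pos_vec_def less_imp_le)
  qed
  ultimately show "p \<in> interior feas"
    by (rule interiorI)
qed

text \<open>The direction \<open>d\<close> raises every power to first order, and a small step along
  it keeps the voltages positive.\<close>

lemma pw_improve:
  assumes V: "pos_vec V" and d: "\<And>i. (neg_jac V *v d) $ i < 0"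
  shows "pw V \<in> interior feas"
proof -
  have "\<forall>\<^sub>F e in at_right (0::real). 0 < (V + e *\<^sub>R d) $ i \<and> pw V $ i < pw (V + e *\<^sub>R d) $ i" for i
  proof -
    have "((\<lambda>e. (V + e *\<^sub>R d) $ i) \<longlongrightarrow> (V + 0 *\<^sub>R d) $ i) (at_right 0)"
      by (intro tendsto_intros)
    moreover have "0 < (V + 0 *\<^sub>R d) $ i"
      using V by (simp add: pos_vec_def)
    ultimately have "\<forall>\<^sub>F e in at_right 0. 0 < (V + e *\<^sub>R d) $ i"
      by (rule order_tendstoD)
    moreover have "((\<lambda>e. - (neg_jac V *v d) $ i - e * (d $ i * (A *v d) $ i))
        \<longlongrightarrow> - (neg_jac V *v d) $ i - 0 * (d $ i * (A *v d) $ i)) (at_right 0)"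
      by (intro tendsto_intros)
    then have "\<forall>\<^sub>F e in at_right 0. 0 < - (neg_jac V *v d) $ i - e * (d $ i * (A *v d) $ i)"
      using d[of i] by (intro order_tendstoD(1)) auto
    ultimately show ?thesis
      using eventually_at_right_less[of "0::real"]
    proof eventually_elim
      case (elim e)
      have "pw (V + e *\<^sub>R d) $ i
          = pw V $ i + e * (- (neg_jac V *v d) $ i - e * (d $ i * (A *v d) $ i))"
        by (simp add: pw_add matrix_vector_mult_scaleR algebra_simps)
      moreover have "0 < e * (- (neg_jac V *v d) $ i - e * (d $ i * (A *v d) $ i))"
        using elim by (intro mult_pos_pos)
      ultimately show ?case
        using elim by linarith
    qed
  qed
  then have "\<forall>\<^sub>F e in at_right (0::real). \<forall>i. 0 < (V + e *\<^sub>R d) $ i \<and> pw V $ i < pw (V + e *\<^sub>R d) $ i"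
    by (intro eventually_all_finite)
  then have "\<exists>e. \<forall>i. 0 < (V + e *\<^sub>R d) $ i \<and> pw V $ i < pw (V + e *\<^sub>R d) $ i"
    by (rule eventually_happens'[rotated]) simp
  then show ?thesis
    unfolding interior_feas pos_vec_def by blast
qed

text \<open>A nonzero eigenvalue of a positive eigenvector of \<open>neg_jac V\<close> would yield
  an improving direction, so at a boundary point the eigenvector is a null vector. Conversely,
  \<open>crit_pw_maximal\<close> rules out strict domination.\<close>

lemma frontier_feas: "p \<in> frontier feas \<longleftrightarrow> (\<exists>V m. crit V m \<and> p = pw V)"
proof
  assume "p \<in> frontier feas"
  then have "p \<in> feas" "p \<notin> interior feas"
    using closed_feas by (auto simp: frontier_def)
  then obtain V where V: "pos_vec V" "p = pw V"
    by (auto simp: feas_def)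
  obtain r w where w: "pos_vec w" "neg_jac V *v w = r *\<^sub>R w"
    by (rule irreducible_Z_matrix_eigenvector[OF neg_jac_Z[OF V(1)] neg_jac_irr[OF V(1)]])
  \<comment> \<open>The factor \<open>- r\<close> makes the image a negative multiple of
    \<open>w\<close> for either sign of \<open>r\<close>.\<close>
  have "neg_jac V *v (- r *\<^sub>R w) = - (r * r) *\<^sub>R w"
    by (simp only: matrix_vector_mult_scaleR w(2) scaleR_scaleR) simp
  then have "(neg_jac V *v (- r *\<^sub>R w)) $ i < 0" if "r \<noteq> 0" for i
    using w(1) that by (auto simp: pos_vec_def zero_less_mult_iff neq_iff)
  then have "r = 0"
    using pw_improve[OF V(1)] \<open>p \<notin> interior feas\<close> V(2) by blast
  then show "\<exists>V m. crit V m \<and> p = pw V"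
    using V w by (auto simp: crit_def)
next
  assume "\<exists>V m. crit V m \<and> p = pw V"
  then obtain V m where V: "crit V m" "p = pw V"
    by blast
  have "p \<in> feas"
    using V by (auto simp: feas_def crit_def)
  moreover have "p \<notin> interior feas"
  proof
    assume "p \<in> interior feas"
    then obtain U where U: "\<And>i. pw V $ i < pw U $ i"
      using V(2) by (auto simp: interior_feas)
    then have "U = V"
      using crit_pw_maximal[OF V(1)] by (simp add: less_imp_le)
    with U show False
      by simp
  qed
  ultimately show "p \<in> frontier feas"
    using closed_feas by (simp add: frontier_def)
qed

lemma crit_pw_unique:
  assumes "crit V m" "crit V' m'" "pw V = pw V'"
  shows "V = V'"
  using crit_pw_maximal[OF assms(2), of V] assms(3) by simp

section \<open>The parametrization\<close>

text \<open>A neighbour \<open>j\<close> of \<open>i\<close> has \<open>A $ i $ j < 0\<close>, so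
  the Z-pattern of \<open>gm m\<close> forces \<open>m $ i \<ge> 0\<close>. If
  \<open>m $ i = 0\<close>, row \<open>i\<close> of \<open>gm m\<close> reduces to its diagonal
  entry \<open>(A *v m) $ i \<le> 0\<close>, which would be an eigenvalue of a nonsingular
  M-matrix.\<close>

lemma M_matrix_gm_pos:
  assumes M: "M_matrix (gm m)" and inv: "invertible (gm m)"
  shows "pos_vec m"
  unfolding pos_vec_def
proof
  fix i
  have diag: "gm m $ i $ i = m $ i * A $ i $ i + (A *v m) $ i"
    by (simp add: gm_def diag_mat_matrix_mult_nth diag_mat_nth)
  have offdiag: "m $ i * A $ i $ j \<le> 0" if "j \<noteq> i" for i j
    using M that gm_offdiag[of i j m] by (metis M_matrix_def Z_matrix_def)
  have neighbour: "\<exists>j. j \<noteq> i \<and> A $ i $ j < 0" if "UNIV \<noteq> {i}" for i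
    using A_irr A_Z that unfolding irreducible_matrix_def Z_matrix_def
    by (metis Compl_iff empty_not_insert order_le_less singletonD)
  \<comment> \<open>Subtracting the diagonal entry leaves a matrix with a zero row, hence a singular
    one.\<close>
  have ev: "\<exists>x. x \<noteq> 0 \<and> gm m *v x = gm m $ i $ i *\<^sub>R x" if "\<And>j. j \<noteq> i \<Longrightarrow> gm m $ i $ j = 0"
  proof -
    define C where "C = gm m - gm m $ i $ i *\<^sub>R mat 1"
    have "C $ i = 0"
      using that by (auto simp: C_def vec_eq_iff mat_def)
    then have "(C *v x) $ i = 0" for x
      by (simp add: matrix_vector_mult_def)
    then have "\<not> (\<exists>B. C ** B = mat 1)"
      by (metis axis_nth matrix_vector_mul_assoc matrix_vector_mul_lid zero_neq_one)
    then have "\<not> invertible C"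
      by (simp add: invertible_right_inverse)
    then obtain x where "x \<noteq> 0" "C *v x = 0"
      by (auto simp: invertible_iff_kernel)
    then show ?thesis
      by (auto simp: C_def matrix_vector_mult_diff_rdistrib scaleR_matrix_vector_assoc[symmetric])
  qed
  have diag_pos: "0 < gm m $ i $ i" if row: "\<And>j. j \<noteq> i \<Longrightarrow> gm m $ i $ j = 0"
  proof -
    obtain x where x: "x \<noteq> 0" "gm m *v x = gm m $ i $ i *\<^sub>R x"
      using ev[OF row] by blast
    have "0 \<le> gm m $ i $ i"
      using complex_eigenvalue_of_real[OF x] M unfolding M_matrix_def by fastforce
    moreover have "gm m $ i $ i \<noteq> 0"
      using x inv unfolding invertible_iff_kernel by fastforce
    ultimately show ?thesis
      by simp
  qed
  show "0 < m $ i"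
  \<comment> \<open>A single load has no neighbours; there the diagonal entry is
    \<open>2 * (m $ i * A $ i $ i)\<close>.\<close>
  proof (cases "UNIV = {i}")
    case True
    then have "\<And>j. j = i"
      by blast
    then have "0 < gm m $ i $ i"
      by (intro diag_pos) auto
    moreover have "(\<Sum>j\<in>UNIV. A $ i $ j * m $ j) = A $ i $ i * m $ i"
      by (subst True) simp
    then have "(A *v m) $ i = A $ i $ i * m $ i"
      by (simp add: matrix_vector_mult_def)
    ultimately have "0 < m $ i * A $ i $ i"
      by (simp add: diag)
    moreover have "0 \<le> A $ i $ i"
      using A_pos_def[of "axis i 1"]
      by (simp add: matrix_vector_mult_basis column_def inner_axis' axis_eq_0_iff)
    ultimately show ?thesis
      by (simp add: zero_less_mult_iff)
  next
    case False
    have nonneg: "0 \<le> m $ j" for j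
    proof -
      have "UNIV \<noteq> {j}"
        using False by (metis UNIV_I singletonD)
      then obtain k where "k \<noteq> j" "A $ j $ k < 0"
        using neighbour by blast
      then show ?thesis
        using offdiag[of k j] by (simp add: mult_le_0_iff)
    qed
    moreover have "m $ i \<noteq> 0"
    proof
      assume mi: "m $ i = 0"
      have "(A *v m) $ i \<le> 0"
        unfolding matrix_vector_mult_def vec_lambda_beta
      proof (rule sum_nonpos)
        fix j
        show "A $ i $ j * m $ j \<le> 0"
          using A_Z nonneg[of j] mi by (cases "j = i") (auto simp: Z_matrix_def mult_nonpos_nonneg)
      qed
      moreover have "0 < gm m $ i $ i"
        by (intro diag_pos) (simp add: gm_offdiag mi)
      ultimately show False
        by (simp add: diag mi)
    qed
    ultimately show ?thesis
      by (simp add: less_le)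
  qed
qed

text \<open>Forwards, \<open>V\<close> is a positive supersolution for \<open>gm m\<close> because
  \<open>gm m *v V = diag_mat m *v b\<close>. Backwards, the M-matrix property makes the eigenvalue
  of a positive eigenvector positive, so \<open>gm m\<close> is inverse-positive and
  \<open>V > 0\<close>.\<close>

lemma crit_iff_M:
  "crit V m \<longleftrightarrow> M_matrix (gm m) \<and> invertible (gm m) \<and> V = matrix_inv (gm m) *v (diag_mat m *v b)"
proof
  assume "crit V m"
  then have V: "pos_vec V" "pos_vec m" "gm m *v V = diag_mat m *v b"
    by (auto simp: crit_iff_gm)
  obtain r w where "0 < r" "pos_vec w" "gm m *v w = r *\<^sub>R w"
    using irreducible_Z_matrix_semipositive[OF gm_Z[OF V(2)] gm_irr[OF V(2)] V(1)]
      diag_mult_b[OF V(2)] V(3) by metis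
  then have "M_matrix (gm m)" "invertible (gm m)"
    using Z_matrix_pos_eigenvector_imp_M_matrix[OF gm_Z[OF V(2)]] by blast+
  then show "M_matrix (gm m) \<and> invertible (gm m) \<and> V = matrix_inv (gm m) *v (diag_mat m *v b)"
    using matrix_inv_mult_eqI[OF _ V(3)] by simp
next
  assume *: "M_matrix (gm m) \<and> invertible (gm m) \<and> V = matrix_inv (gm m) *v (diag_mat m *v b)"
  then have m: "pos_vec m"
    using M_matrix_gm_pos by blast
  have V: "gm m *v V = diag_mat m *v b"
    using * by (metis matrix_inv_right_left(1) matrix_vector_mul_assoc matrix_vector_mul_lid)
  obtain r w where w: "pos_vec w" "gm m *v w = r *\<^sub>R w"
    by (rule irreducible_Z_matrix_eigenvector[OF gm_Z[OF m] gm_irr[OF m]])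
  have "0 \<le> r"
    using complex_eigenvalue_of_real[OF pos_vec_neq_0[OF w(1)] w(2)] * unfolding M_matrix_def by fastforce
  moreover have "r \<noteq> 0"
    using w pos_vec_neq_0[OF w(1)] * unfolding invertible_iff_kernel by force
  ultimately have "0 < (gm m *v w) $ i" for i
    using w by (simp add: pos_vec_def)
  then have "pos_vec V"
    using Z_matrix_inverse_positive[OF gm_Z[OF m] gm_irr[OF m] w(1)] diag_mult_b[OF m] V by simp
  then show "crit V m"
    using m V by (simp add: crit_iff_gm)
qed

text \<open>A strict supersolution makes \<open>neg_jac V\<close> inverse-positive, and unit vectors
  reveal the columns of the inverse. Conversely, the preimage of the all-ones vector is a strict
  supersolution.\<close>

lemma stable_eq:
  "stable = {V. pos_vec V \<and> invertible (- neg_jac V) \<and> (\<forall>i j. matrix_inv (- neg_jac V) $ i $ j < 0)}"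
proof (intro set_eqI iffI)
  fix V assume "V \<in> stable"
  then obtain x where V: "pos_vec V" and x: "pos_vec x" "\<And>i. 0 < (neg_jac V *v x) $ i"
    by (auto simp: stable_def)
  have "neg_jac V *v x \<noteq> 0"
    using x(2) by (metis less_irrefl zero_index)
  then obtain r w where "0 < r" "pos_vec w" "neg_jac V *v w = r *\<^sub>R w"
    using irreducible_Z_matrix_semipositive[OF neg_jac_Z[OF V] neg_jac_irr[OF V] x(1)] x(2)
    by (metis less_imp_le)
  then have "invertible (neg_jac V)"
    using Z_matrix_pos_eigenvector_imp_M_matrix[OF neg_jac_Z[OF V]] by blast
  moreover have neg: "(- neg_jac V) *v y = - (neg_jac V *v y)" for y
    by (metis diff_0 matrix_vector_mult_0 matrix_vector_mult_diff_rdistrib)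
  ultimately have inv: "invertible (- neg_jac V)"
    unfolding invertible_iff_kernel by simp
  have "matrix_inv (- neg_jac V) $ i $ j < 0" for i j
  proof -
    define y where "y = - (matrix_inv (- neg_jac V) *v axis j 1)"
    have "neg_jac V *v y = - (neg_jac V *v (matrix_inv (- neg_jac V) *v axis j 1))"
      unfolding y_def by (metis diff_0 matrix_vector_mult_0_right matrix_vector_mult_diff_distrib)
    also have "\<dots> = axis j 1"
      using inv by (metis neg matrix_inv_right_left(1) matrix_vector_mul_assoc matrix_vector_mul_lid)
    finally have "neg_jac V *v y = axis j 1" .
    then have "pos_vec y"
      using Z_matrix_inverse_positive[OF neg_jac_Z[OF V] neg_jac_irr[OF V] x, of y]
      by (simp add: axis_eq_0_iff) (simp add: axis_def)
    then have "0 < y $ i"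
      by (simp add: pos_vec_def)
    then show ?thesis
      by (simp add: y_def matrix_vector_mult_basis column_def)
  qed
  with V inv show "V \<in> {V. pos_vec V \<and> invertible (- neg_jac V) \<and> (\<forall>i j. matrix_inv (- neg_jac V) $ i $ j < 0)}"
    by blast
next
  fix V assume "V \<in> {V. pos_vec V \<and> invertible (- neg_jac V) \<and> (\<forall>i j. matrix_inv (- neg_jac V) $ i $ j < 0)}"
  then have V: "pos_vec V" and inv: "invertible (- neg_jac V)"
    and less: "\<And>i j. matrix_inv (- neg_jac V) $ i $ j < 0"
    by auto
  define w where "w = - (matrix_inv (- neg_jac V) *v 1)"
  have "0 < (\<Sum>j\<in>UNIV. - (matrix_inv (- neg_jac V) $ i $ j))" for i
    using less by (intro sum_pos) auto
  then have "pos_vec w"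
    by (simp add: w_def pos_vec_def matrix_vector_mult_def sum_negf)
  moreover have "neg_jac V *v w = 1"
  proof -
    have "neg_jac V *v w = (- neg_jac V) *v (matrix_inv (- neg_jac V) *v 1)"
      unfolding w_def
      by (metis (no_types) diff_0 matrix_vector_mult_0 matrix_vector_mult_0_right matrix_vector_mult_diff_distrib matrix_vector_mult_diff_rdistrib)
    also have "\<dots> = 1"
      using inv by (simp add: matrix_vector_mul_assoc matrix_inv_right_left)
    finally show ?thesis .
  qed
  ultimately show "V \<in> stable"
    using V by (auto simp: stable_def)
qed

text \<open>Each row of \<open>neg_jac V *v m = 0\<close> can be solved for the load current
  \<open>b $ i - (A *v V) $ i\<close>, which is then substituted into \<open>pw\<close>.\<close>

lemma crit_pw:
  assumes "crit V m"
  shows "pw V = (diag_mat V ** diag_mat V ** matrix_inv (diag_mat m) ** A) *v m"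
proof -
  have m: "pos_vec m" "m $ i \<noteq> 0" and null: "(neg_jac V *v m) $ i = 0" for i
    using assms by (auto simp: crit_def pos_vec_def less_imp_neq[symmetric])
  have "(diag_mat V ** diag_mat V ** matrix_inv (diag_mat m) ** A) *v m
      = (\<chi> i. V $ i * (V $ i * ((A *v m) $ i / m $ i)))"
    by (simp add: diag_mat_mult_vec matrix_inv_diag_mat_mult[OF m(1)] flip: matrix_vector_mul_assoc)
  moreover have "pw V $ i = V $ i * (V $ i * ((A *v m) $ i / m $ i))" for i
  proof -
    have "b $ i - (A *v V) $ i = V $ i * ((A *v m) $ i / m $ i)"
      using null[of i] m(2)[of i] by (simp add: neg_jac_mult field_simps)
    then show ?thesis
      by (simp add: pw_def)
  qed
  ultimately show ?thesis
    by (simp add: vec_eq_iff)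
qed

lemma crit_normalize:
  assumes "crit V m"
  obtains m' where "crit V m'" "one_norm m' = 1"
proof -
  have "pos_vec m"
    using assms by (simp add: crit_def)
  then have n: "0 < one_norm m"
    unfolding one_norm_def pos_vec_def by (intro sum_pos) (auto simp: less_imp_neq[symmetric])
  have "one_norm ((1 / one_norm m) *\<^sub>R m) = 1"
    using n by (simp add: one_norm_def abs_mult flip: sum_divide_distrib)
  with crit_mult[OF assms, of "1 / one_norm m"] n that show ?thesis
    by simp
qed

lemma crit_normalized_unique:
  assumes "crit V m" "crit V m'"
    and "one_norm m = 1" "one_norm m' = 1"
  shows "m' = m"
proof -
  obtain t where t: "m' = t *\<^sub>R m"
    by (rule crit_unique_up_to_scale[OF assms(1,2)])
  have "one_norm m' = \<bar>t\<bar> * one_norm m"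
    by (simp add: one_norm_def t abs_mult sum_distrib_left)
  then have "\<bar>t\<bar> = 1"
    using assms(3,4) by simp
  moreover have "0 < m $ i" "0 < t * m $ i" for i
    using assms(1,2) by (auto simp: crit_def pos_vec_def t)
  then have "0 < t"
    by (metis zero_less_mult_pos2)
  ultimately show ?thesis
    by (simp add: t)
qed

end

section \<open>From the Kirchhoff matrix to the abstract grid\<close>

lemma kirchhoff_power_grid:
  fixes Y :: "real^('n::finite + 'm::finite)^('n + 'm)"
  assumes K: "kirchhoff_matrix Y" and irr: "irreducible_matrix (Y_LL Y)" and V: "pos_vec V\<^sub>S"
  shows "power_grid (Y_LL Y) (I_star Y V\<^sub>S)"
proof (rule power_grid.intro)
  have sym: "Y $ i $ j = Y $ j $ i" for i j
  proof -
    have "transpose Y $ i $ j = Y $ i $ j"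
      using K by (simp add: kirchhoff_matrix_def)
    then show ?thesis
      by (simp add: transpose_def)
  qed
  have Z: "Y $ i $ j \<le> 0" if "i \<noteq> j" for i j
    using K that by (simp add: kirchhoff_matrix_def)
  show "transpose (Y_LL Y) = Y_LL Y"
    by (simp add: vec_eq_iff transpose_def Y_LL_def sym)
  show "Z_matrix (Y_LL Y)"
    by (simp add: Z_matrix_def Y_LL_def Z)
  show "irreducible_matrix (Y_LL Y)"
    by (rule irr)
  have LS: "Y $ Inl i $ Inr j \<le> 0" for i j
    by (simp add: Z)
  \<comment> \<open>Without an edge between a load and a source, only loads would be reachable from
    a load, against connectedness.\<close>
  obtain i0 j0 where ij: "Y $ Inl i0 $ Inr j0 \<noteq> 0"
  proof (rule ccontr)
    assume no: "\<not> thesis"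
    note no_edge = that
    fix i :: 'n and j :: 'm
    have "(Inl i, Inr j) \<in> {(k, l). k \<noteq> l \<and> Y $ k $ l \<noteq> 0}\<^sup>*"
      using K by (simp add: kirchhoff_matrix_def)
    moreover have "v \<in> range Inl" if "(Inl i, v) \<in> {(k, l). k \<noteq> l \<and> Y $ k $ l \<noteq> 0}\<^sup>*" for v
      using that
    proof (induction rule: rtrancl_induct)
      case (step v w)
      then show ?case
        using no no_edge by (cases w) auto
    qed simp
    ultimately show False
      by blast
  qed
  \<comment> \<open>Zero row sums convert the row sums of the load block into total edge weights to
    the sources.\<close>
  have one: "(Y_LL Y *v 1) $ i = (\<Sum>j\<in>UNIV. - Y $ Inl i $ Inr j)" for i
  proof -
    have "0 = (\<Sum>v\<in>UNIV. Y $ Inl i $ v)"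
      using K by (simp add: kirchhoff_matrix_def)
    also have "\<dots> = (\<Sum>j\<in>UNIV. Y $ Inl i $ Inl j) + (\<Sum>j\<in>UNIV. Y $ Inl i $ Inr j)"
      by (simp add: sum.Plus o_def flip: UNIV_Plus_UNIV)
    finally show ?thesis
      by (simp add: matrix_vector_mult_def Y_LL_def sum_negf)
  qed
  show "0 \<le> (Y_LL Y *v 1) $ i" for i
    unfolding one using LS by (intro sum_nonneg) simp
  have "0 < (Y_LL Y *v 1) $ i0"
    unfolding one using LS ij by (intro sum_pos2[of _ j0]) (auto simp: less_le)
  then show "Y_LL Y *v 1 \<noteq> 0"
    by (metis less_irrefl zero_index)
  have I: "I_star Y V\<^sub>S $ i = (\<Sum>j\<in>UNIV. - Y $ Inl i $ Inr j * V\<^sub>S $ j)" for i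
    by (simp add: I_star_def Y_LS_def matrix_vector_mult_def sum_negf)
  have VS: "0 < V\<^sub>S $ j" for j
    using V by (simp add: pos_vec_def)
  have term_nonneg: "0 \<le> - Y $ Inl i $ Inr j * V\<^sub>S $ j" for i j
    using LS[of i j] VS[of j] by (intro mult_nonneg_nonneg) auto
  show "0 \<le> I_star Y V\<^sub>S $ i" for i
    unfolding I by (intro sum_nonneg term_nonneg)
  have "0 < - Y $ Inl i0 $ Inr j0 * V\<^sub>S $ j0"
    using LS[of i0 j0] ij VS[of j0] by (intro mult_pos_pos) auto
  then have "0 < I_star Y V\<^sub>S $ i0"
    unfolding I using term_nonneg by (intro sum_pos2[of _ j0]) auto
  then show "I_star Y V\<^sub>S \<noteq> 0"
    by (metis less_irrefl zero_index)
qed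

theorem theorem3p8:
  fixes Y :: "real^('n::finite + 'm::finite)^('n + 'm)"
    and V\<^sub>S :: "real^'m"
  assumes "kirchhoff_matrix Y"
    and "irreducible_matrix (Y_LL Y)"
    and "pos_vec V\<^sub>S"
  shows "(\<forall>P \<in> frontier (feasible Y V\<^sub>S).
            (\<exists>!(V, \<mu>). V \<in> frontier (D_set Y V\<^sub>S) \<and> \<mu> \<in> M1_set Y \<and>
                       P = P_c Y V\<^sub>S V \<and> V = psi Y V\<^sub>S \<mu>) \<and>
            (\<forall>V \<mu>. V \<in> frontier (D_set Y V\<^sub>S) \<and> \<mu> \<in> M1_set Y \<and>
                    P = P_c Y V\<^sub>S V \<and> V = psi Y V\<^sub>S \<mu> \<longrightarrow>
                    P = (diag_mat V ** diag_mat V ** matrix_inv (diag_mat \<mu>) ** Y_LL Y) *v \<mu>))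
       \<and> frontier (feasible Y V\<^sub>S) =
           {(diag_mat (psi Y V\<^sub>S \<mu>) ** diag_mat (psi Y V\<^sub>S \<mu>) **
             matrix_inv (diag_mat \<mu>) ** Y_LL Y) *v \<mu> | \<mu>. \<mu> \<in> M1_set Y}"
proof -
  interpret power_grid "Y_LL Y" "I_star Y V\<^sub>S"
    by (rule kirchhoff_power_grid[OF assms])
  have V_star: "Y_LL Y *v V_star Y V\<^sub>S = I_star Y V\<^sub>S"
    unfolding V_star_def
    by (metis A_invertible matrix_inv_right_left(1) matrix_vector_mul_assoc matrix_vector_mul_lid)
  have load: "Y_LL Y *v (V_star Y V\<^sub>S - V) = I_star Y V\<^sub>S - Y_LL Y *v V" for V
    by (simp add: matrix_vector_mult_diff_distrib V_star)
  have pc: "P_c Y V\<^sub>S = pw"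
    by (simp add: fun_eq_iff P_c_def load pw_def diag_mat_mult_vec)
  have feas: "feasible Y V\<^sub>S = feas"
    by (auto simp: feasible_def feas_def pc)
  have "jacobian (P_c Y V\<^sub>S) (at V) = - neg_jac V" for V
    by (simp add: jacobian_P_c load neg_jac_def vec_eq_iff diag_mat_nth)
  then have D: "D_set Y V\<^sub>S = stable"
    by (simp add: D_set_def stable_eq)
  have "g_mat Y = gm"
    by (simp add: fun_eq_iff g_mat_def gm_def)
  then have crit: "crit V \<mu> \<longleftrightarrow> \<mu> \<in> M_set Y \<and> V = psi Y V\<^sub>S \<mu>" for V \<mu>
    by (simp add: crit_iff_M M_set_def psi_def)
  \<comment> \<open>By \<open>frontier_stable\<close>, lying on the boundary of \<open>D\<close>
    already follows from \<open>crit V \<mu>\<close>, so the conditions collapse to a normalised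
    critical pair.\<close>
  have frontD: "V \<in> frontier (D_set Y V\<^sub>S) \<and> \<mu> \<in> M1_set Y \<and> P = P_c Y V\<^sub>S V \<and> V = psi Y V\<^sub>S \<mu>
      \<longleftrightarrow> crit V \<mu> \<and> one_norm \<mu> = 1 \<and> P = pw V" for P V \<mu>
    using crit frontier_stable[of V] by (auto simp: D pc M1_set_def)
  have frontF: "P \<in> frontier (feasible Y V\<^sub>S) \<longleftrightarrow> (\<exists>V \<mu>. crit V \<mu> \<and> one_norm \<mu> = 1 \<and> P = pw V)" for P
  proof
    assume "P \<in> frontier (feasible Y V\<^sub>S)"
    then obtain V m where V: "crit V m" "P = pw V"
      unfolding feas frontier_feas by blast
    obtain \<mu> where "crit V \<mu>" "one_norm \<mu> = 1"
      by (rule crit_normalize[OF V(1)])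
    with V(2) show "\<exists>V \<mu>. crit V \<mu> \<and> one_norm \<mu> = 1 \<and> P = pw V"
      by blast
  qed (unfold feas frontier_feas, blast)
  show ?thesis
  proof (intro conjI ballI allI impI)
    fix P assume "P \<in> frontier (feasible Y V\<^sub>S)"
    then obtain V \<mu> where V: "crit V \<mu>" "one_norm \<mu> = 1" "P = pw V"
      using frontF by blast
    \<comment> \<open>The power vector determines \<open>V\<close>, and \<open>\<mu>\<close> is then
      the normalised positive vector in the one-dimensional kernel of the Jacobian at
      \<open>V\<close>.\<close>
    have uniq: "V' = V \<and> \<mu>' = \<mu>" if "crit V' \<mu>'" "one_norm \<mu>' = 1" "P = pw V'" for V' \<mu>'
    proof -
      have "V' = V"
        using crit_pw_unique[OF that(1) V(1)] that(3) V(3) by simp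
      then show ?thesis
        using crit_normalized_unique[OF V(1) _ V(2) that(2)] that(1) by simp
    qed
    have "\<exists>!(V, \<mu>). crit V \<mu> \<and> one_norm \<mu> = 1 \<and> P = pw V"
    proof (rule ex1I[of _ "(V, \<mu>)"])
      show "case (V, \<mu>) of (V, \<mu>) \<Rightarrow> crit V \<mu> \<and> one_norm \<mu> = 1 \<and> P = pw V"
        using V by simp
      show "x = (V, \<mu>)" if "case x of (V, \<mu>) \<Rightarrow> crit V \<mu> \<and> one_norm \<mu> = 1 \<and> P = pw V" for x
        using that uniq[of "fst x" "snd x"] unfolding case_prod_beta by (simp only: prod_eq_iff fst_conv snd_conv)
    qed
    then show "\<exists>!(V, \<mu>). V \<in> frontier (D_set Y V\<^sub>S) \<and> \<mu> \<in> M1_set Y \<and>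
        P = P_c Y V\<^sub>S V \<and> V = psi Y V\<^sub>S \<mu>"
      unfolding frontD .
  next
    fix P V \<mu>
    assume "V \<in> frontier (D_set Y V\<^sub>S) \<and> \<mu> \<in> M1_set Y \<and> P = P_c Y V\<^sub>S V \<and> V = psi Y V\<^sub>S \<mu>"
    then have "crit V \<mu>" "P = pw V"
      unfolding frontD by simp_all
    then show "P = (diag_mat V ** diag_mat V ** matrix_inv (diag_mat \<mu>) ** Y_LL Y) *v \<mu>"
      by (simp only: crit_pw)
  next
    have "frontier (feasible Y V\<^sub>S) = {pw (psi Y V\<^sub>S \<mu>) | \<mu>. \<mu> \<in> M1_set Y}"
      by (auto simp: frontF crit M1_set_def)
    also have "\<dots> = {(diag_mat (psi Y V\<^sub>S \<mu>) ** diag_mat (psi Y V\<^sub>S \<mu>) **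
        matrix_inv (diag_mat \<mu>) ** Y_LL Y) *v \<mu> | \<mu>. \<mu> \<in> M1_set Y}"
    proof (intro Collect_cong ex_cong1 rev_conj_cong refl)
      fix P \<mu> assume "\<mu> \<in> M1_set Y"
      then have "crit (psi Y V\<^sub>S \<mu>) \<mu>"
        by (simp add: crit M1_set_def)
      then show "P = pw (psi Y V\<^sub>S \<mu>) \<longleftrightarrow> P = (diag_mat (psi Y V\<^sub>S \<mu>) **
          diag_mat (psi Y V\<^sub>S \<mu>) ** matrix_inv (diag_mat \<mu>) ** Y_LL Y) *v \<mu>"
        by (simp only: crit_pw)
    qed
    finally show "frontier (feasible Y V\<^sub>S) = {(diag_mat (psi Y V\<^sub>S \<mu>) **
        diag_mat (psi Y V\<^sub>S \<mu>) ** matrix_inv (diag_mat \<mu>) ** Y_LL Y) *v \<mu> | \<mu>. \<mu> \<in> M1_set Y}" .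
  qed
qed

end
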